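(* The following statements are equivalent for every uncountable cardinal $\delta$: \begin{enumerate} \item The cardinal $\delta$ is a Vopěnka cardinal. \item For every set ${\mathcal{C}}$ of structures of the same type with ${\mathcal{C}}\in V_{\delta+1}\setminus V_\delta$, there exists a cardinal $\kappa<\delta$ with the property that the principle $\mathrm{SR}_{\mathcal{C}}(\kappa)$ (equivalently, $\mathrm{HSR}_{\mathcal{C}}(\kappa)$, or $\mathrm{VSR}_{\mathcal{C}}(\kappa)$) holds. \end{enumerate}
   Context: Work in ZFC. Structures are structures for countable first-order languages; the cardinality of a structure is that of its domain. A Vopěnka cardinal is an inaccessible cardinal $\delta$ such that for every set ${\mathcal{C}}$ of structures of the same type with ${\mathcal{C}}\in V_{\delta+1}\setminus V_\delta$, there exist $A,B\in{\mathcal{C}}$ with $A\neq B$ and an elementary embedding from $A$ to $B$. For a class ${\mathcal{C}}$ of structures of the same type and an infinite cardinal $\kappa$: $\mathrm{SR}_{\mathcal{C}}(\kappa)$ states that for every $B\in{\mathcal{C}}$ there is $A\in{\mathcal{C}}$ of cardinality less than $\kappa$ and an elementary embedding of $A$ into $B$; $\mathrm{HSR}_{\mathcal{C}}(\kappa)$ states that for every $B\in{\mathcal{C}}$ there is $A\in{\mathcal{C}}\cap H_\kappa$ and an elementary embedding of $A$ into $B$; $\mathrm{VSR}_{\mathcal{C}}(\kappa)$ states that for every $B\in{\mathcal{C}}$ there is $A\in{\mathcal{C}}\cap V_\kappa$ and an elementary embedding of $A$ into $B$. *)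

theory Defs
  imports Main "HOL-Library.Equipollence" "HOL-Library.Countable_Set"
begin

text \<open>
  HOL cannot construct a model of ZFC, so the universe of sets is an arbitrary type of the
  following class. The subsets of the type are the classes; in particular
  Separation and Replacement are stated for arbitrary HOL predicates and functions. The axiom of
  choice needs no clause of its own, since it follows from Replacement and the choice operator of
  HOL (lemma \<open>zfc_choice\<close> below).
\<close>

class zfc_universe =
  fixes elts :: "'a \<Rightarrow> 'a set"
  assumes extensionality: "elts x = elts y \<Longrightarrow> x = y"
    and foundation: "wf {(x, y). x \<in> elts y}"
    and pairing: "\<exists>z. elts z = {x, y}"
    and union: "\<exists>y. elts y = (\<Union>z\<in>elts x. elts z)"
    and power_set: "\<exists>y. elts y = {z. elts z \<subseteq> elts x}"
    and infinity: "\<exists>x. (\<exists>e\<in>elts x. elts e = {}) \<and>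
          (\<forall>y\<in>elts x. \<exists>s\<in>elts x. elts s = insert y (elts y))"
    and separation: "\<exists>y. elts y = {z \<in> elts x. P z}"
    and replacement: "\<exists>y. elts y = F ` elts x"

lemma zfc_choice:
  fixes x :: "'a::zfc_universe"
  assumes "\<forall>y\<in>elts x. elts y \<noteq> {}"
    and "\<forall>y\<in>elts x. \<forall>z\<in>elts x. y \<noteq> z \<longrightarrow> elts y \<inter> elts z = {}"
  shows "\<exists>c. \<forall>y\<in>elts x. \<exists>!z. z \<in> elts y \<and> z \<in> elts c"
proof -
  define F where "F = (\<lambda>y::'a. SOME z. z \<in> elts y)"
  have F: "F y \<in> elts y" if "y \<in> elts x" for y
    using assms(1) that some_in_eq unfolding F_def by blast
  obtain c where c: "elts c = F ` elts x"
    using replacement by blast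
  have "z = F y" if "y \<in> elts x" "z \<in> elts y" "z \<in> elts c" for y z
    using that F assms(2) c by (metis disjoint_iff imageE)
  then show ?thesis
    using F c by (intro exI[of _ c] ballI ex1I[of _ "F _"]) auto
qed


section \<open>Ordinals, cardinals and the cumulative hierarchy\<close>

text \<open>Meaningful only if the given class is a set.\<close>

definition mkset :: "'a::zfc_universe set \<Rightarrow> 'a" where
  "mkset X = (THE x. elts x = X)"

definition succ :: "'a::zfc_universe \<Rightarrow> 'a" where
  "succ x = mkset (insert x (elts x))"

primrec ord_of_nat :: "nat \<Rightarrow> 'a::zfc_universe" where
  "ord_of_nat 0 = mkset {}"
| "ord_of_nat (Suc n) = succ (ord_of_nat n)"

text \<open>By Foundation, \<open>\<in>\<close> well-orders every set that it orders linearly.\<close>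

definition ordinal :: "'a::zfc_universe \<Rightarrow> bool" where
  "ordinal \<alpha> \<longleftrightarrow> (\<forall>x\<in>elts \<alpha>. elts x \<subseteq> elts \<alpha>) \<and>
     (\<forall>x\<in>elts \<alpha>. \<forall>y\<in>elts \<alpha>. x \<in> elts y \<or> x = y \<or> y \<in> elts x)"

definition cardinal :: "'a::zfc_universe \<Rightarrow> bool" where
  "cardinal \<kappa> \<longleftrightarrow> ordinal \<kappa> \<and> (\<forall>\<alpha>\<in>elts \<kappa>. \<not> elts \<alpha> \<approx> elts \<kappa>)"

definition infinite_cardinal :: "'a::zfc_universe \<Rightarrow> bool" where
  "infinite_cardinal \<kappa> \<longleftrightarrow> cardinal \<kappa> \<and> infinite (elts \<kappa>)"

definition uncountable_cardinal :: "'a::zfc_universe \<Rightarrow> bool" where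
  "uncountable_cardinal \<kappa> \<longleftrightarrow> cardinal \<kappa> \<and> uncountable (elts \<kappa>)"

definition regular_cardinal :: "'a::zfc_universe \<Rightarrow> bool" where
  "regular_cardinal \<kappa> \<longleftrightarrow> infinite_cardinal \<kappa> \<and>
     (\<forall>X\<subseteq>elts \<kappa>. X \<prec> elts \<kappa> \<longrightarrow> (\<exists>\<alpha>\<in>elts \<kappa>. X \<subseteq> elts \<alpha>))"

definition strong_limit_cardinal :: "'a::zfc_universe \<Rightarrow> bool" where
  "strong_limit_cardinal \<kappa> \<longleftrightarrow> infinite_cardinal \<kappa> \<and>
     (\<forall>\<alpha>\<in>elts \<kappa>. Pow (elts \<alpha>) \<prec> elts \<kappa>)"

definition inaccessible :: "'a::zfc_universe \<Rightarrow> bool" where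
  "inaccessible \<kappa> \<longleftrightarrow>
     uncountable_cardinal \<kappa> \<and> regular_cardinal \<kappa> \<and> strong_limit_cardinal \<kappa>"

text \<open>\<open>V\<^sub>\<alpha> = (\<Union>\<beta><\<alpha>. \<P>(V\<^sub>\<beta>))\<close>, as a class.\<close>

function Vset :: "'a::zfc_universe \<Rightarrow> 'a set" where
  "Vset \<alpha> = (\<Union>\<beta>\<in>elts \<alpha>. {x. elts x \<subseteq> Vset \<beta>})"
  by auto
termination
  by (relation "{(x, y). x \<in> elts y}") (auto simp: foundation)

declare Vset.simps [simp del]

definition trcl :: "'a::zfc_universe \<Rightarrow> 'a set" where
  "trcl x = {y. (y, x) \<in> {(u, v). u \<in> elts v}\<^sup>+}"

definition Hset :: "'a::zfc_universe \<Rightarrow> 'a set" where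
  "Hset \<kappa> = {x. trcl x \<prec> elts \<kappa>}"


section \<open>Structures\<close>

text \<open>Kuratowski pairs, set-theoretic functions, and finite sequences as functions on
  natural numbers.\<close>

definition pair :: "'a::zfc_universe \<Rightarrow> 'a \<Rightarrow> 'a" where
  "pair x y = mkset {mkset {x}, mkset {x, y}}"

definition pfst :: "'a::zfc_universe \<Rightarrow> 'a" where
  "pfst p = (THE x. \<exists>y. p = pair x y)"

definition psnd :: "'a::zfc_universe \<Rightarrow> 'a" where
  "psnd p = (THE y. \<exists>x. p = pair x y)"

definition function_on :: "'a::zfc_universe \<Rightarrow> 'a set \<Rightarrow> bool" where
  "function_on f X \<longleftrightarrow>
     (\<forall>p\<in>elts f. \<exists>x\<in>X. \<exists>y. p = pair x y) \<and> (\<forall>x\<in>X. \<exists>!y. pair x y \<in> elts f)"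

definition app :: "'a::zfc_universe \<Rightarrow> 'a \<Rightarrow> 'a" where
  "app f x = (THE y. pair x y \<in> elts f)"

definition tuple :: "'a::zfc_universe list \<Rightarrow> 'a" where
  "tuple xs = mkset {pair (ord_of_nat i) (xs ! i) | i. i < length xs}"

definition tuples :: "'a::zfc_universe set \<Rightarrow> nat \<Rightarrow> 'a set" where
  "tuples X n = {tuple xs | xs. set xs \<subseteq> X \<and> length xs = n}"

text \<open>Constants are function symbols of arity 0. The symbols are themselves sets, so that
  structures can be coded as sets.\<close>

record 's language =
  rels :: "'s set"
  funs :: "'s set"
  rel_arity :: "'s \<Rightarrow> nat"
  fun_arity :: "'s \<Rightarrow> nat"

definition countable_language :: "'s language \<Rightarrow> bool" where
  "countable_language L \<longleftrightarrow> countable (rels L) \<and> countable (funs L)"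

text \<open>An \<open>L\<close>-structure is the set \<open>(D, (R, F))\<close>, where \<open>D\<close> is its domain and \<open>R\<close>, \<open>F\<close> are the
  functions interpreting the relation symbols and the function symbols of \<open>L\<close>.\<close>

definition domain :: "'a::zfc_universe \<Rightarrow> 'a set" where
  "domain A = elts (pfst A)"

definition rel_interp :: "'a::zfc_universe \<Rightarrow> 'a \<Rightarrow> 'a" where
  "rel_interp A r = app (pfst (psnd A)) r"

definition fun_interp :: "'a::zfc_universe \<Rightarrow> 'a \<Rightarrow> 'a" where
  "fun_interp A f = app (psnd (psnd A)) f"

definition is_structure :: "'a::zfc_universe language \<Rightarrow> 'a \<Rightarrow> bool" where
  "is_structure L A \<longleftrightarrow>
     (\<exists>D R F. A = pair D (pair R F) \<and> function_on R (rels L) \<and> function_on F (funs L)) \<and>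
     domain A \<noteq> {} \<and>
     (\<forall>r\<in>rels L. elts (rel_interp A r) \<subseteq> tuples (domain A) (rel_arity L r)) \<and>
     (\<forall>f\<in>funs L. function_on (fun_interp A f) (tuples (domain A) (fun_arity L f)) \<and>
        (\<forall>t\<in>tuples (domain A) (fun_arity L f). app (fun_interp A f) t \<in> domain A))"


section \<open>Satisfaction and elementary embeddings\<close>

datatype 's tm = Var nat | App 's "'s tm list"

datatype 's fm =
  Eq "'s tm" "'s tm" | Rel 's "'s tm list" | Neg "'s fm" | Conj "'s fm" "'s fm" | Ex nat "'s fm"

primrec wf_tm :: "'s language \<Rightarrow> 's tm \<Rightarrow> bool" where
  "wf_tm L (Var n) \<longleftrightarrow> True"
| "wf_tm L (App f ts) \<longleftrightarrow>
     f \<in> funs L \<and> length ts = fun_arity L f \<and> list_all id (map (wf_tm L) ts)"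

primrec wf_fm :: "'s language \<Rightarrow> 's fm \<Rightarrow> bool" where
  "wf_fm L (Eq t u) \<longleftrightarrow> wf_tm L t \<and> wf_tm L u"
| "wf_fm L (Rel r ts) \<longleftrightarrow> r \<in> rels L \<and> length ts = rel_arity L r \<and> list_all (wf_tm L) ts"
| "wf_fm L (Neg \<phi>) \<longleftrightarrow> wf_fm L \<phi>"
| "wf_fm L (Conj \<phi> \<psi>) \<longleftrightarrow> wf_fm L \<phi> \<and> wf_fm L \<psi>"
| "wf_fm L (Ex n \<phi>) \<longleftrightarrow> wf_fm L \<phi>"

primrec val :: "'a::zfc_universe \<Rightarrow> (nat \<Rightarrow> 'a) \<Rightarrow> 'a tm \<Rightarrow> 'a" where
  "val A v (Var n) = v n"
| "val A v (App f ts) = app (fun_interp A f) (tuple (map (val A v) ts))"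

primrec sat :: "'a::zfc_universe \<Rightarrow> (nat \<Rightarrow> 'a) \<Rightarrow> 'a fm \<Rightarrow> bool" where
  "sat A v (Eq t u) \<longleftrightarrow> val A v t = val A v u"
| "sat A v (Rel r ts) \<longleftrightarrow> tuple (map (val A v) ts) \<in> elts (rel_interp A r)"
| "sat A v (Neg \<phi>) \<longleftrightarrow> \<not> sat A v \<phi>"
| "sat A v (Conj \<phi> \<psi>) \<longleftrightarrow> sat A v \<phi> \<and> sat A v \<psi>"
| "sat A v (Ex n \<phi>) \<longleftrightarrow> (\<exists>d\<in>domain A. sat A (v(n := d)) \<phi>)"

text \<open>Only the restriction of \<open>j\<close> to \<open>domain A\<close> matters; by Replacement, its graph is a set.\<close>

definition elementary_embedding ::
    "'a::zfc_universe language \<Rightarrow> ('a \<Rightarrow> 'a) \<Rightarrow> 'a \<Rightarrow> 'a \<Rightarrow> bool" where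
  "elementary_embedding L j A B \<longleftrightarrow> j ` domain A \<subseteq> domain B \<and>
     (\<forall>\<phi> v. wf_fm L \<phi> \<and> range v \<subseteq> domain A \<longrightarrow> (sat A v \<phi> \<longleftrightarrow> sat B (j \<circ> v) \<phi>))"


section \<open>Vopenka cardinals and structural reflection\<close>

text \<open>\<open>structures_of_type L C\<close>: \<open>L\<close> witnesses that \<open>C\<close> is a class of structures of the same type.\<close>

definition structures_of_type :: "'a::zfc_universe language \<Rightarrow> 'a set \<Rightarrow> bool" where
  "structures_of_type L C \<longleftrightarrow> countable_language L \<and> (\<forall>A\<in>C. is_structure L A)"

definition vopenka_cardinal :: "'a::zfc_universe \<Rightarrow> bool" where
  "vopenka_cardinal \<delta> \<longleftrightarrow> inaccessible \<delta> \<and>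
     (\<forall>L C. structures_of_type L (elts C) \<and> C \<in> Vset (succ \<delta>) - Vset \<delta> \<longrightarrow>
        (\<exists>A\<in>elts C. \<exists>B\<in>elts C. A \<noteq> B \<and> (\<exists>j. elementary_embedding L j A B)))"

definition SR :: "'a::zfc_universe language \<Rightarrow> 'a set \<Rightarrow> 'a \<Rightarrow> bool" where
  "SR L C \<kappa> \<longleftrightarrow>
     (\<forall>B\<in>C. \<exists>A\<in>C. domain A \<prec> elts \<kappa> \<and> (\<exists>j. elementary_embedding L j A B))"

definition HSR :: "'a::zfc_universe language \<Rightarrow> 'a set \<Rightarrow> 'a \<Rightarrow> bool" where
  "HSR L C \<kappa> \<longleftrightarrow> (\<forall>B\<in>C. \<exists>A\<in>C \<inter> Hset \<kappa>. \<exists>j. elementary_embedding L j A B)"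

definition VSR :: "'a::zfc_universe language \<Rightarrow> 'a set \<Rightarrow> 'a \<Rightarrow> bool" where
  "VSR L C \<kappa> \<longleftrightarrow> (\<forall>B\<in>C. \<exists>A\<in>C \<inter> Vset \<kappa>. \<exists>j. elementary_embedding L j A B)"

end

theory Submission
  imports Defs
begin

text \<open>
  Every self-map of an ordinal \<open>\<alpha> + 1\<close> that respects \<open>\<in>\<close> and a fixed choice of cofinal
  \<open>\<omega>\<close>-sequences (\<open>ladders\<close>) is the identity (Vopenka, Pultr and Hedrlin). So subsets of
  \<open>\<alpha> < \<delta>\<close> can be coded into structures of arbitrary size without elementary embeddings between
  different ones. If \<open>\<delta>\<close> were singular or not a strong limit, an unbounded set of such structures
  would violate reflection; hence reflection below \<open>\<delta>\<close> makes \<open>\<delta>\<close> inaccessible.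

  For inaccessible \<open>\<delta>\<close> there are fewer than \<open>\<delta>\<close> isomorphism types of structures of size below
  \<open>\<kappa> < \<delta>\<close>, so SR passes to VSR and HSR at larger cardinals. Under VSR at \<open>\<kappa>\<close>, some other member
  of \<open>C\<close> embeds into each member outside \<open>V\<^sub>\<kappa>\<close>. Conversely, if SR fails at all
  \<open>\<kappa> < \<delta>\<close>, then \<open>C\<close> has members of unboundedly many cardinalities into which no smaller member embeds,
  and these contradict the Vopenka property.
\<close>

section \<open>Sets as small classes\<close>

text \<open>Singles out the HOL sets that are represented in the universe. Only for these does the
  definite description in \<open>mkset\<close> return the intended value.\<close>

definition small :: "'a::zfc_universe set \<Rightarrow> bool" where
  "small X \<longleftrightarrow> (\<exists>x. elts x = X)"

lemma inj_elts: "inj (elts :: 'a::zfc_universe \<Rightarrow> 'a set)"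
  by (simp add: injI extensionality)

lemma small_elts [simp]: "small (elts x)"
  by (auto simp: small_def)

lemma mkset_elts [simp]: "mkset (elts x) = x"
  unfolding mkset_def by (rule the_equality) (auto intro: extensionality)

lemma elts_mkset [simp]: "small X \<Longrightarrow> elts (mkset X) = X"
  by (metis mkset_elts small_def)

lemma small_subset: "small Y \<Longrightarrow> X \<subseteq> Y \<Longrightarrow> small X"
proof -
  assume "small Y" "X \<subseteq> Y"
  then obtain y z where "elts y = Y" "elts z = {u \<in> elts y. u \<in> X}"
    using separation unfolding small_def by metis
  then have "elts z = X"
    using \<open>X \<subseteq> Y\<close> by auto
  then show ?thesis
    by (auto simp: small_def)
qed

lemma small_image:
  fixes F :: "'a::zfc_universe \<Rightarrow> 'a"
  assumes "small X"
  shows "small (F ` X)"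
  using assms replacement[of F] unfolding small_def by blast

lemma small_empty [simp]: "small {}"
  unfolding small_def using separation[of _ "\<lambda>_. False"] by simp

lemma small_pair [simp]: "small {x, y}"
  unfolding small_def by (rule pairing)

lemma small_singleton [simp]: "small {x}"
  using small_pair[of x x] by simp

text \<open>Replacement applied to the codes \<open>mkset (F x)\<close> turns the family into a set
  of the universe, whose union then exists.\<close>

lemma small_UN:
  fixes F :: "'a::zfc_universe \<Rightarrow> 'a set"
  assumes "small X" "\<And>x. x \<in> X \<Longrightarrow> small (F x)"
  shows "small (\<Union>x\<in>X. F x)"
proof -
  obtain a where a: "elts a = (\<lambda>x. mkset (F x)) ` X"
    using small_image[OF assms(1)] unfolding small_def by blast
  obtain b where "elts b = (\<Union>z\<in>elts a. elts z)"
    using union by blast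
  then have "elts b = (\<Union>x\<in>X. F x)"
    using a assms(2) by auto
  then show ?thesis
    by (auto simp: small_def)
qed

lemma small_Un: "small X \<Longrightarrow> small Y \<Longrightarrow> small (X \<union> Y)"
  using small_UN[of "{mkset X, mkset Y}" elts] by simp

lemma small_insert: "small X \<Longrightarrow> small (insert x X)"
  using small_Un[of "{x}" X] by simp

lemma elts_succ [simp]: "elts (succ x) = insert x (elts x)"
  by (simp add: succ_def small_insert)

lemma mem_irrefl [simp]: "x \<notin> elts (x::'a::zfc_universe)"
  using foundation wf_not_refl by fastforce

lemma mem_asym: "x \<in> elts y \<Longrightarrow> (y::'a::zfc_universe) \<notin> elts x"
  using wf_not_sym[OF foundation] by auto

lemma mem_induct [case_names step]:
  "(\<And>x. (\<And>y. y \<in> elts x \<Longrightarrow> P y) \<Longrightarrow> P x) \<Longrightarrow> P (x::'a::zfc_universe)"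
  using wf_induct_rule[OF foundation, of P] by simp

lemma mem_minimal:
  assumes "(x::'a::zfc_universe) \<in> X"
  obtains m where "m \<in> X" "\<And>y. y \<in> elts m \<Longrightarrow> y \<notin> X"
  using wfE_min[OF foundation assms] by auto

lemma mem_acyc3: "x \<in> elts y \<Longrightarrow> y \<in> elts z \<Longrightarrow> (z::'a::zfc_universe) \<notin> elts x"
proof
  assume a: "x \<in> elts y" "y \<in> elts z" "z \<in> elts x"
  obtain m where "m \<in> {x, y, z}" "\<And>u. u \<in> elts m \<Longrightarrow> u \<notin> {x, y, z}"
    by (rule mem_minimal[of x "{x, y, z}"]) auto
  then show False
    using a by auto
qed

section \<open>Ordinals\<close>

text \<open>For \<open>y\<close> in \<open>x\<close> in \<beta>, the only obstacles to
  \<open>y\<close> in \<beta> are \<open>y\<close> = \<beta> and \<beta> in \<open>y\<close>; they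
  give membership cycles of length two and three, which Foundation forbids.\<close>

lemma ordinal_elem: "ordinal \<alpha> \<Longrightarrow> \<beta> \<in> elts \<alpha> \<Longrightarrow> ordinal \<beta>"
proof -
  assume a: "ordinal \<alpha>" "\<beta> \<in> elts \<alpha>"
  then have sub: "elts \<beta> \<subseteq> elts \<alpha>"
    by (auto simp: ordinal_def)
  have "y \<in> elts \<beta>" if "x \<in> elts \<beta>" "y \<in> elts x" for x y
  proof -
    have "y \<in> elts \<alpha>"
      using a(1) that sub unfolding ordinal_def by blast
    then have "y \<in> elts \<beta> \<or> y = \<beta> \<or> \<beta> \<in> elts y"
      using a unfolding ordinal_def by blast
    then show ?thesis
      using that mem_acyc3 mem_asym by blast
  qed
  then show ?thesis
    using a(1) sub unfolding ordinal_def by blast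
qed

lemma ordinal_trans: "ordinal \<alpha> \<Longrightarrow> \<beta> \<in> elts \<alpha> \<Longrightarrow> \<gamma> \<in> elts \<beta> \<Longrightarrow> \<gamma> \<in> elts \<alpha>"
  unfolding ordinal_def by blast

text \<open>A membership-minimal element of the difference has exactly the elements of \<beta>, so
  it is \<beta>.\<close>

lemma ordinal_psubset:
  assumes "ordinal \<alpha>" "ordinal \<beta>" "elts \<beta> \<subset> elts \<alpha>"
  shows "\<beta> \<in> elts \<alpha>"
proof -
  obtain a where "a \<in> elts \<alpha> - elts \<beta>"
    using assms(3) by auto
  then obtain m where m: "m \<in> elts \<alpha> - elts \<beta>" "\<And>y. y \<in> elts m \<Longrightarrow> y \<notin> elts \<alpha> - elts \<beta>"
    by (rule mem_minimal) blast
  have "elts m = elts \<beta>"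
  proof (intro equalityI subsetI)
    show "x \<in> elts \<beta>" if "x \<in> elts m" for x
      using m that assms(1) ordinal_trans by blast
    show "x \<in> elts m" if "x \<in> elts \<beta>" for x
      using m(1) that assms unfolding ordinal_def by (metis DiffD1 DiffD2 psubsetD subsetD)
  qed
  then show ?thesis
    using m(1) extensionality by blast
qed

text \<open>The intersection of the two is an ordinal. If it were proper in both, it would be an
  element of both and hence of itself.\<close>

lemma ordinal_linear:
  assumes "ordinal \<alpha>" "ordinal \<beta>"
  shows "\<alpha> \<in> elts \<beta> \<or> \<alpha> = \<beta> \<or> \<beta> \<in> elts \<alpha>"
proof -
  define m where "m = mkset (elts \<alpha> \<inter> elts \<beta>)"
  have m: "elts m = elts \<alpha> \<inter> elts \<beta>"
    unfolding m_def by (rule elts_mkset) (meson inf_le1 small_elts small_subset)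
  then have "ordinal m"
    using assms unfolding ordinal_def by blast
  then show ?thesis
    using ordinal_psubset[OF assms(1), of m] ordinal_psubset[OF assms(2), of m]
      ordinal_psubset[OF assms] ordinal_psubset[OF assms(2,1)] m
    by (metis Int_iff extensionality inf.absorb_iff2 inf_commute inf_le1 mem_irrefl psubsetI)
qed

text \<open>A transitive set of ordinals is linearly ordered automatically, by comparability of
  ordinals.\<close>

lemma ordinalI:
  assumes "\<And>x y. x \<in> elts \<alpha> \<Longrightarrow> y \<in> elts x \<Longrightarrow> y \<in> elts \<alpha>"
    and "\<And>x. x \<in> elts \<alpha> \<Longrightarrow> ordinal x"
  shows "ordinal \<alpha>"
  unfolding ordinal_def using assms ordinal_linear by blast

lemma ordinal_not_mem_iff:
  "ordinal \<alpha> \<Longrightarrow> ordinal \<beta> \<Longrightarrow> \<alpha> \<notin> elts \<beta> \<longleftrightarrow> elts \<beta> \<subseteq> elts \<alpha>"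
  by (metis mem_irrefl ordinal_linear ordinal_trans subsetD subsetI)

lemma ordinal_succ: "ordinal \<alpha> \<Longrightarrow> ordinal (succ \<alpha>)"
  by (rule ordinalI) (auto intro: ordinal_trans ordinal_elem)

lemma ordinal_UN:
  assumes "small X" "\<And>x. x \<in> X \<Longrightarrow> ordinal x"
  shows "ordinal (mkset (\<Union>(elts ` X)))" "elts (mkset (\<Union>(elts ` X))) = \<Union>(elts ` X)"
proof -
  show *: "elts (mkset (\<Union>(elts ` X))) = \<Union>(elts ` X)"
    using small_UN[OF assms(1), of elts] by simp
  show "ordinal (mkset (\<Union>(elts ` X)))"
    by (rule ordinalI) (auto simp: * assms intro: ordinal_trans ordinal_elem dest: assms(2))
qed

section \<open>Natural numbers and \<omega> inside the universe\<close>

lemma ordinal_ord_of_nat [simp]: "ordinal (ord_of_nat n)"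
  by (induction n) (auto intro: ordinal_succ simp: ordinal_def)

lemma ord_of_nat_mem: "m < n \<Longrightarrow> ord_of_nat m \<in> elts (ord_of_nat n)"
  by (induction n) (auto simp: less_Suc_eq)

lemma inj_ord_of_nat: "inj (ord_of_nat :: nat \<Rightarrow> 'a::zfc_universe)"
  by (metis injI linorder_neqE_nat mem_irrefl ord_of_nat_mem)

lemma ord_of_nat_eq_iff [simp]: "ord_of_nat m = (ord_of_nat n :: 'a::zfc_universe) \<longleftrightarrow> m = n"
  by (rule inj_eq[OF inj_ord_of_nat])

lemma small_range_ord_of_nat: "small (range (ord_of_nat :: nat \<Rightarrow> 'a::zfc_universe))"
proof -
  obtain x :: 'a where x: "\<exists>e\<in>elts x. elts e = {}"
    "\<forall>y\<in>elts x. \<exists>s\<in>elts x. elts s = insert y (elts y)"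
    using infinity by blast
  have "ord_of_nat n \<in> elts x" for n
  proof (induction n)
    case 0
    then show ?case
      using x(1) by (metis mkset_elts ord_of_nat.simps(1))
  next
    case (Suc n)
    then show ?case
      using x(2) by (metis mkset_elts ord_of_nat.simps(2) succ_def)
  qed
  then show ?thesis
    by (metis image_subsetI small_elts small_subset)
qed

text \<open>Replacement only speaks of functions from the universe to itself, so \<open>f\<close> is
  reindexed along the copy of the natural numbers in it.\<close>

lemma small_range_nat: "small (range (f :: nat \<Rightarrow> 'a::zfc_universe))"
proof -
  have "range f = (\<lambda>x. f (the_inv ord_of_nat x)) ` range (ord_of_nat :: nat \<Rightarrow> 'a)"
    by (auto simp: the_inv_f_f[OF inj_ord_of_nat] image_image)
  then show ?thesis
    by (metis small_image small_range_ord_of_nat)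
qed

lemma ordinal_omega: "ordinal (mkset (range ord_of_nat) :: 'a::zfc_universe)"
proof (rule ordinalI)
  note * = elts_mkset[OF small_range_ord_of_nat, where 'a = 'a]
  have "y \<in> range ord_of_nat" if "y \<in> elts (ord_of_nat n :: 'a)" for y n
    using that by (induction n) auto
  then show "y \<in> elts (mkset (range ord_of_nat) :: 'a)"
    if "x \<in> elts (mkset (range ord_of_nat))" "y \<in> elts x" for x y
    using that by (auto simp: *)
  show "ordinal x" if "x \<in> elts (mkset (range ord_of_nat) :: 'a)" for x
    using that by (auto simp: *)
qed

section \<open>Cardinals\<close>

text \<open>Every HOL set carries a well-ordering of least type, and well-orderings are
  comparable.\<close>

lemma lepoll_total: "A \<lesssim> B \<or> B \<lesssim> A"
  unfolding lepoll_def card_of_ordLeq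
  by (rule ordLeq_total) (auto simp: card_of_Well_order)

lemma not_lesspoll_iff: "\<not> A \<prec> B \<longleftrightarrow> B \<lesssim> A"
  by (meson lepoll_total lesspoll_def lepoll_antisym eqpoll_sym eqpoll_imp_lepoll)

lemma cardinal_ordinal: "cardinal \<kappa> \<Longrightarrow> ordinal \<kappa>"
  by (simp add: cardinal_def)

lemma cardinal_elem_lesspoll:
  assumes "cardinal \<kappa>" "\<alpha> \<in> elts \<kappa>"
  shows "elts \<alpha> \<prec> elts \<kappa>"
  using assms unfolding cardinal_def ordinal_def lesspoll_def
  by (simp add: subset_imp_lepoll)

text \<open>Otherwise \<kappa> is contained in \<alpha> + 1; since one more point does not enlarge
  an infinite set, \<kappa> would inject into \<alpha>.\<close>

lemma infinite_cardinal_limit: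
  assumes "infinite_cardinal \<kappa>" "\<alpha> \<in> elts \<kappa>"
  shows "succ \<alpha> \<in> elts \<kappa>"
proof (rule ccontr)
  have \<kappa>: "cardinal \<kappa>" "infinite (elts \<kappa>)" "ordinal \<kappa>"
    using assms(1) by (auto simp: infinite_cardinal_def cardinal_def)
  assume "succ \<alpha> \<notin> elts \<kappa>"
  then have "elts \<kappa> \<subseteq> insert \<alpha> (elts \<alpha>)"
    using \<kappa>(3) assms(2) ordinal_not_mem_iff ordinal_succ ordinal_elem elts_succ by metis
  moreover from this have "infinite (elts \<alpha>)"
    using \<kappa>(2) finite_subset by blast
  ultimately have "elts \<kappa> \<lesssim> elts \<alpha>"
    by (meson infinite_insert_lepoll lepoll_trans subset_imp_lepoll)
  then show False
    using cardinal_elem_lesspoll[OF \<kappa>(1) assms(2)] not_lesspoll_iff by blast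
qed

text \<open>The least ordinal up to \<alpha> into which \<open>X\<close> injects is a
  cardinal.\<close>

lemma cardinal_above:
  assumes "ordinal \<alpha>" "X \<lesssim> elts \<alpha>"
  obtains \<kappa> where "cardinal \<kappa>" "X \<lesssim> elts \<kappa>" "\<kappa> \<in> elts (succ \<alpha>)"
proof -
  have "\<alpha> \<in> {\<beta>. \<beta> \<in> elts (succ \<alpha>) \<and> X \<lesssim> elts \<beta>}"
    using assms by simp
  then obtain \<kappa> where "\<kappa> \<in> {\<beta>. \<beta> \<in> elts (succ \<alpha>) \<and> X \<lesssim> elts \<beta>}"
    and min: "\<And>\<beta>. \<beta> \<in> elts \<kappa> \<Longrightarrow> \<beta> \<notin> {\<beta>. \<beta> \<in> elts (succ \<alpha>) \<and> X \<lesssim> elts \<beta>}"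
    by (rule mem_minimal) blast
  then have \<kappa>: "\<kappa> \<in> elts (succ \<alpha>)" "X \<lesssim> elts \<kappa>"
    by auto
  have "\<not> elts \<beta> \<approx> elts \<kappa>" if "\<beta> \<in> elts \<kappa>" for \<beta>
  proof
    assume "elts \<beta> \<approx> elts \<kappa>"
    then have "X \<lesssim> elts \<beta>"
      using \<kappa>(2) eqpoll_sym lepoll_trans2 by blast
    moreover have "\<beta> \<in> elts (succ \<alpha>)"
      using \<kappa>(1) that ordinal_trans[OF ordinal_succ[OF assms(1)]] by blast
    ultimately show False
      using min[OF that] by blast
  qed
  then have "cardinal \<kappa>"
    unfolding cardinal_def using \<kappa>(1) assms(1) ordinal_elem ordinal_succ by blast
  then show thesis
    using that \<kappa> by blast
qed

text \<open>The function \<open>c\<close> below is the Mostowski collapse of a copy of \<open>Y\<close> in \<open>\<delta>\<close>; as \<open>c x \<le> x\<close>, the collapse stays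
  below \<open>\<delta>\<close>.\<close>

lemma lesspoll_cardinal_bound:
  fixes \<delta> :: "'a::zfc_universe" and Y :: "'b set"
  assumes "cardinal \<delta>" "Y \<prec> elts \<delta>"
  obtains \<alpha> where "\<alpha> \<in> elts \<delta>" "Y \<lesssim> elts \<alpha>"
proof -
  have ord: "ordinal \<delta>"
    using assms(1) by (rule cardinal_ordinal)
  obtain f where f: "inj_on f Y" "f ` Y \<subseteq> elts \<delta>"
    using lesspoll_imp_lepoll[OF assms(2)] unfolding lepoll_def by blast
  define X where "X = f ` Y"
  have X: "X \<subseteq> elts \<delta>" "Y \<approx> X"
    using f by (auto simp: X_def inj_on_image_eqpoll_self eqpoll_sym)
  define c :: "'a \<Rightarrow> 'a" where
    "c = wfrec {(x, y). x \<in> elts y} (\<lambda>c x. mkset (c ` (elts x \<inter> X)))"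
  have c: "c x = mkset (c ` (elts x \<inter> X))" for x
    by (subst c_def, subst wfrec[OF foundation])
      (auto simp: c_def cut_def intro!: arg_cong[where f = mkset] image_cong)
  have elts_c: "elts (c x) = c ` (elts x \<inter> X)" for x
    by (metis Int_lower1 c elts_mkset small_elts small_image small_subset)
  have ord_c: "ordinal (c x) \<and> elts (c x) \<subseteq> elts x" if "ordinal x" for x
    using that
  proof (induction x rule: mem_induct)
    case (step x)
    then have IH: "ordinal (c y) \<and> elts (c y) \<subseteq> elts y" if "y \<in> elts x" for y
      using that ordinal_elem by blast
    have "ordinal (c x)"
    proof (rule ordinalI)
      show "v \<in> elts (c x)" if "u \<in> elts (c x)" "v \<in> elts u" for u v
        using that ordinal_trans[OF step.prems] unfolding elts_c by (auto simp: elts_c)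
      show "ordinal u" if "u \<in> elts (c x)" for u
        using that IH by (auto simp: elts_c)
    qed
    moreover have "c y \<in> elts x" if "y \<in> elts x" for y
      using IH[OF that] that step.prems
      by (metis ordinal_elem ordinal_linear ordinal_not_mem_iff ordinal_trans)
    ultimately show ?case
      by (auto simp: elts_c)
  qed
  have mono: "c x \<in> elts (c y)" if "x \<in> elts y" "x \<in> X" for x y
    using that by (auto simp: elts_c)
  have inj: "inj_on c X"
  proof (rule inj_onI)
    fix x y assume "x \<in> X" "y \<in> X" "c x = c y"
    then have "x \<notin> elts y" "y \<notin> elts x"
      using mono[of x y] mono[of y x] by auto
    then show "x = y"
      using ordinal_linear \<open>x \<in> X\<close> \<open>y \<in> X\<close> X(1) ord ordinal_elem by blast
  qed
  have "elts \<delta> \<inter> X = X"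
    using X by blast
  then have "elts (c \<delta>) = c ` X"
    using elts_c[of \<delta>] by simp
  then have "elts (c \<delta>) \<approx> Y"
    using X(2) inj by (metis eqpoll_sym eqpoll_trans inj_on_image_eqpoll_self)
  moreover from this have "c \<delta> \<noteq> \<delta>"
    using assms(2) by (auto simp: lesspoll_def dest: eqpoll_sym)
  then have "c \<delta> \<in> elts \<delta>"
    using ord_c[OF ord] ordinal_psubset[OF ord] extensionality by blast
  ultimately show thesis
    using that by (meson eqpoll_imp_lepoll eqpoll_sym)
qed

section \<open>The cumulative hierarchy\<close>

lemma mem_Vset_iff: "x \<in> Vset \<alpha> \<longleftrightarrow> (\<exists>\<beta>\<in>elts \<alpha>. elts x \<subseteq> Vset \<beta>)"
  by (subst Vset.simps) auto

lemma Vset_mono: "elts \<beta> \<subseteq> elts \<alpha> \<Longrightarrow> Vset \<beta> \<subseteq> Vset \<alpha>"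
  using mem_Vset_iff by blast

lemma Vset_mono_mem: "ordinal \<alpha> \<Longrightarrow> \<beta> \<in> elts \<alpha> \<Longrightarrow> Vset \<beta> \<subseteq> Vset \<alpha>"
  by (rule Vset_mono) (auto intro: ordinal_trans)

lemma Vset_trans: "ordinal \<alpha> \<Longrightarrow> x \<in> Vset \<alpha> \<Longrightarrow> elts x \<subseteq> Vset \<alpha>"
  using Vset_mono_mem mem_Vset_iff by blast

lemma mem_Vset_succ_iff: "ordinal \<alpha> \<Longrightarrow> x \<in> Vset (succ \<alpha>) \<longleftrightarrow> elts x \<subseteq> Vset \<alpha>"
  by (auto simp: mem_Vset_iff[of x "succ \<alpha>"] dest: Vset_mono_mem)

lemma ordinal_subset_Vset: "elts \<alpha> \<subseteq> Vset \<alpha>"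
proof (induction \<alpha> rule: mem_induct)
  case (step \<alpha>)
  then show ?case
    using mem_Vset_iff by blast
qed

text \<open>Such a \<beta> is included in some \<open>Vset \<gamma>\<close> with \<gamma> <
  \<alpha>. By induction its elements are below \<gamma>, so \<beta> \<le> \<gamma> <
  \<alpha>.\<close>

lemma ordinal_mem_Vset:
  "ordinal \<alpha> \<Longrightarrow> ordinal \<beta> \<Longrightarrow> \<beta> \<in> Vset \<alpha> \<Longrightarrow> \<beta> \<in> elts \<alpha>"
proof (induction \<alpha> arbitrary: \<beta> rule: mem_induct)
  case (step \<alpha>)
  obtain \<gamma> where \<gamma>: "\<gamma> \<in> elts \<alpha>" "elts \<beta> \<subseteq> Vset \<gamma>"
    using step.prems(3) mem_Vset_iff by blast
  have "elts \<beta> \<subseteq> elts \<gamma>"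
    using step.IH[OF \<gamma>(1)] \<gamma> step.prems ordinal_elem by blast
  then show ?case
    using \<gamma>(1) step.prems
    by (metis ordinal_elem ordinal_linear ordinal_not_mem_iff ordinal_trans)
qed

section \<open>Transitive closure, rank and hereditary cardinality\<close>

lemma trcl_eq: "trcl x = elts x \<union> (\<Union>y\<in>elts x. trcl y)"
  by (auto simp: trcl_def intro: r_into_trancl trancl_into_trancl elim: tranclE)

lemma trcl_trans: "y \<in> trcl x \<Longrightarrow> trcl y \<subseteq> trcl x"
  by (auto simp: trcl_def)

lemma small_trcl: "small (trcl x)"
proof (induction x rule: mem_induct)
  case (step x)
  then show ?case
    by (subst trcl_eq) (intro small_Un small_UN small_elts)
qed

lemma trcl_subset_Vset: "ordinal \<alpha> \<Longrightarrow> x \<in> Vset \<alpha> \<Longrightarrow> trcl x \<subseteq> Vset \<alpha>"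
proof (induction x rule: mem_induct)
  case (step x)
  then show ?case
    using Vset_trans by (subst trcl_eq) blast
qed

text \<open>The usual rank, with recursion over the whole transitive closure. This avoids suprema of
  successors and exhibits the rank as an image of \<open>trcl x\<close>, which bounds its
  cardinality.\<close>

function rank :: "'a::zfc_universe \<Rightarrow> 'a" where
  "rank x = mkset (rank ` trcl x)"
  by auto
termination
  by (relation "{(x, y). x \<in> elts y}\<^sup>+") (auto simp: foundation wf_trancl trcl_def)

declare rank.simps [simp del]

lemma elts_rank: "elts (rank x) = rank ` trcl x"
  by (subst rank.simps) (simp add: small_image small_trcl)

lemma ordinal_rank: "ordinal (rank x)"
proof (induction x rule: wf_induct_rule[OF wf_trancl[OF foundation]])
  case (1 x)
  show ?case
  proof (rule ordinalI)
    show "v \<in> elts (rank x)" if "u \<in> elts (rank x)" "v \<in> elts u" for u v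
      using that trcl_trans unfolding elts_rank by (fastforce simp: elts_rank)
    show "ordinal u" if "u \<in> elts (rank x)" for u
      using that 1 by (auto simp: elts_rank trcl_def)
  qed
qed

lemma subset_Vset_rank: "elts x \<subseteq> Vset (rank x)"
proof (induction x rule: mem_induct)
  case (step x)
  have "rank y \<in> elts (rank x)" if "y \<in> elts x" for y
    using that by (auto simp: elts_rank trcl_def)
  then show ?case
    using step mem_Vset_iff by blast
qed

text \<open>As an image of \<open>trcl x\<close>, the rank of \<open>x\<close> has fewer than
  \<kappa> elements; being an ordinal, it lies below the cardinal \<kappa>.\<close>

lemma Hset_subset_Vset:
  assumes "cardinal \<kappa>"
  shows "Hset \<kappa> \<subseteq> Vset \<kappa>"
proof
  fix x assume "x \<in> Hset \<kappa>"
  then have "elts (rank x) \<prec> elts \<kappa>"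
    unfolding Hset_def elts_rank using image_lepoll lesspoll_trans1 by blast
  then have "rank x \<in> elts \<kappa>"
    by (metis assms cardinal_ordinal not_lesspoll_iff ordinal_not_mem_iff ordinal_rank subset_imp_lepoll)
  then show "x \<in> Vset \<kappa>"
    using subset_Vset_rank mem_Vset_iff by blast
qed

section \<open>Pairs and structures\<close>

lemma mkset_eq_iff: "small X \<Longrightarrow> small Y \<Longrightarrow> mkset X = mkset Y \<longleftrightarrow> X = Y"
  by (metis elts_mkset)

lemma elts_pair: "elts (pair x y) = {mkset {x}, mkset {x, y}}"
  by (simp add: pair_def)

lemma pair_eq_iff [simp]: "pair x y = pair x' y' \<longleftrightarrow> x = x' \<and> y = y'"
proof
  assume "pair x y = pair x' y'"
  then have "{mkset {x}, mkset {x, y}} = {mkset {x'}, mkset {x', y'}}"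
    by (metis elts_pair)
  then show "x = x' \<and> y = y'"
    using mkset_eq_iff[of "{x}" "{x'}"] mkset_eq_iff[of "{x}" "{x', y'}"]
      mkset_eq_iff[of "{x, y}" "{x'}"] mkset_eq_iff[of "{x, y}" "{x', y'}"]
    by (auto simp: doubleton_eq_iff)
qed simp

lemma pfst_pair [simp]: "pfst (pair x y) = x"
  by (simp add: pfst_def)

lemma psnd_pair [simp]: "psnd (pair x y) = y"
  by (simp add: psnd_def)

lemma mkset_subset_Vset: "ordinal \<alpha> \<Longrightarrow> small X \<Longrightarrow> X \<subseteq> Vset \<alpha> \<Longrightarrow> mkset X \<in> Vset (succ \<alpha>)"
  by (simp add: mem_Vset_succ_iff)

lemma pair_mem_Vset:
  assumes "ordinal \<alpha>" "x \<in> Vset \<alpha>" "y \<in> Vset \<alpha>"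
  shows "pair x y \<in> Vset (succ (succ \<alpha>))"
  unfolding pair_def using assms
  by (intro mkset_subset_Vset ordinal_succ small_pair) (auto intro!: mkset_subset_Vset)

lemma domain_pair [simp]: "domain (pair D Q) = elts D"
  by (simp add: domain_def)

text \<open>The set \<open>D\<close> is reached from the Kuratowski pair through its element
  \<open>mkset {D}\<close>, and \<open>Vset \<alpha>\<close> is transitive.\<close>

lemma domain_subset_Vset:
  assumes "ordinal \<alpha>" "pair D Q \<in> Vset \<alpha>"
  shows "domain (pair D Q) \<subseteq> Vset \<alpha>"
proof -
  have "mkset {D} \<in> Vset \<alpha>"
    using Vset_trans[OF assms] by (simp add: elts_pair)
  then have "D \<in> Vset \<alpha>"
    using Vset_trans[OF assms(1)] by fastforce
  then show ?thesis
    using Vset_trans[OF assms(1)] by simp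
qed

lemma domain_subset_trcl:
  assumes "is_structure L A"
  shows "domain A \<subseteq> trcl A"
proof
  fix x assume x: "x \<in> domain A"
  obtain D Q where A: "A = pair D Q"
    using assms unfolding is_structure_def by blast
  let ?E = "{(u, v). u \<in> elts v}"
  have "(x, D) \<in> ?E" "(D, mkset {D}) \<in> ?E" "(mkset {D}, A) \<in> ?E"
    using x by (auto simp: A elts_pair)
  then show "x \<in> trcl A"
    unfolding trcl_def by (metis (mono_tags, lifting) mem_Collect_eq r_into_trancl trancl_trans)
qed

section \<open>Composition and injectivity of elementary embeddings\<close>

lemma elementary_embedding_trans:
  assumes "elementary_embedding L j A B" "elementary_embedding L k B C"
  shows "elementary_embedding L (k \<circ> j) A C"
proof -
  have "range (j \<circ> v) \<subseteq> domain B" if "range v \<subseteq> domain A" for v :: "nat \<Rightarrow> 'a"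
    using that assms(1) unfolding elementary_embedding_def by auto
  then show ?thesis
    using assms unfolding elementary_embedding_def by (auto simp: o_assoc image_subset_iff)
qed

lemma elementary_embedding_refl: "elementary_embedding L id A A"
  by (simp add: elementary_embedding_def)

text \<open>Elementarity for the formula \<open>Eq (Var 0) (Var 1)\<close> makes the embedding
  injective.\<close>

lemma elementary_embedding_lepoll:
  assumes "elementary_embedding L j A B"
  shows "domain A \<lesssim> domain B"
proof -
  have "x = y" if "x \<in> domain A" "y \<in> domain A" "j x = j y" for x y
  proof -
    define v where "v = (\<lambda>n::nat. if n = 0 then x else y)"
    have "range v \<subseteq> domain A" "wf_fm L (Eq (Var 0) (Var 1))"
      using that by (auto simp: v_def)
    then have "sat A v (Eq (Var 0) (Var 1)) \<longleftrightarrow> sat B (j \<circ> v) (Eq (Var 0) (Var 1))"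
      using assms unfolding elementary_embedding_def by blast
    then show ?thesis
      using that(3) by (simp add: v_def)
  qed
  then show ?thesis
    using assms unfolding elementary_embedding_def lepoll_def inj_on_def by blast
qed

section \<open>Inaccessible cardinals\<close>

lemma Pow_lepoll_mono:
  assumes "A \<lesssim> B"
  shows "Pow A \<lesssim> Pow B"
proof -
  obtain f where "inj_on f A" "f ` A \<subseteq> B"
    using assms unfolding lepoll_def by blast
  then have "inj_on ((`) f) (Pow A)" "(`) f ` Pow A \<subseteq> Pow B"
    by (simp_all add: inj_on_image_Pow image_Pow_mono)
  then show ?thesis
    unfolding lepoll_def by blast
qed

text \<open>Kuratowski pairs are sets of subsets. The crude bound suffices below a strong limit,
  where it replaces the arithmetic of infinite products.\<close>

lemma square_lepoll_Pow_Pow: "A \<times> A \<lesssim> Pow (Pow A)"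
  unfolding lepoll_def
proof (intro exI conjI)
  show "inj_on (\<lambda>(x, y). {{x}, {x, y}}) (A \<times> A)"
  proof (rule inj_onI, clarify)
    fix x y x' y' :: 'a assume "{{x}, {x, y}} = {{x'}, {x', y'}}"
    then show "x = x' \<and> y = y'"
      unfolding doubleton_eq_iff by blast
  qed
qed auto

context
  fixes \<delta> :: "'a::zfc_universe"
  assumes inacc: "inaccessible \<delta>"
begin

lemma inaccessible_infinite_cardinal: "infinite_cardinal \<delta>"
  using inacc by (simp add: inaccessible_def regular_cardinal_def)

lemma inaccessible_cardinal: "cardinal \<delta>"
  using inaccessible_infinite_cardinal by (simp add: infinite_cardinal_def)

lemma inaccessible_ordinal: "ordinal \<delta>"
  using inaccessible_cardinal by (rule cardinal_ordinal)

lemma lepoll_elem_lesspoll: "\<alpha> \<in> elts \<delta> \<Longrightarrow> X \<lesssim> elts \<alpha> \<Longrightarrow> X \<prec> elts \<delta>"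
  using cardinal_elem_lesspoll[OF inaccessible_cardinal] lesspoll_trans1 by blast

lemma lesspoll_bound2:
  fixes X :: "'b set" and Y :: "'c set"
  assumes "X \<prec> elts \<delta>" "Y \<prec> elts \<delta>"
  obtains \<gamma> where "\<gamma> \<in> elts \<delta>" "X \<lesssim> elts \<gamma>" "Y \<lesssim> elts \<gamma>"
proof -
  obtain \<alpha> \<beta> where *: "\<alpha> \<in> elts \<delta>" "X \<lesssim> elts \<alpha>" "\<beta> \<in> elts \<delta>" "Y \<lesssim> elts \<beta>"
    using lesspoll_cardinal_bound[OF inaccessible_cardinal] assms by metis
  then have "elts \<alpha> \<subseteq> elts \<beta> \<or> elts \<beta> \<subseteq> elts \<alpha>"
    by (metis inaccessible_ordinal ordinal_elem ordinal_not_mem_iff ordinal_trans subsetI)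
  then show thesis
    using that * by (meson lepoll_trans subset_imp_lepoll)
qed

lemma Pow_lesspoll:
  assumes "X \<prec> elts \<delta>"
  shows "Pow X \<prec> elts \<delta>"
proof -
  obtain \<alpha> where "\<alpha> \<in> elts \<delta>" "X \<lesssim> elts \<alpha>"
    using lesspoll_cardinal_bound[OF inaccessible_cardinal assms] .
  then show ?thesis
    using inacc Pow_lepoll_mono lesspoll_trans1
    unfolding inaccessible_def strong_limit_cardinal_def by blast
qed

lemma Times_lesspoll:
  assumes "X \<prec> elts \<delta>" "Y \<prec> elts \<delta>"
  shows "X \<times> Y \<prec> elts \<delta>"
proof -
  obtain \<gamma> where \<gamma>: "\<gamma> \<in> elts \<delta>" "X \<lesssim> elts \<gamma>" "Y \<lesssim> elts \<gamma>"
    using lesspoll_bound2[OF assms] .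
  then have "X \<times> Y \<lesssim> Pow (Pow (elts \<gamma>))"
    using times_lepoll_mono square_lepoll_Pow_Pow lepoll_trans by blast
  moreover have "Pow (Pow (elts \<gamma>)) \<prec> elts \<delta>"
    using \<gamma>(1) by (intro Pow_lesspoll) (rule lepoll_elem_lesspoll, auto)
  ultimately show ?thesis
    by (rule lesspoll_trans1)
qed

lemma inaccessible_bounded:
  assumes "I \<prec> elts \<delta>" "\<And>i. i \<in> I \<Longrightarrow> f i \<in> elts \<delta>"
  obtains \<beta> where "\<beta> \<in> elts \<delta>" "\<And>i. i \<in> I \<Longrightarrow> f i \<in> elts \<beta>"
proof -
  have "f ` I \<prec> elts \<delta>"
    using assms(1) image_lepoll lesspoll_trans1 by blast
  moreover have "f ` I \<subseteq> elts \<delta>"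
    using assms(2) by blast
  ultimately obtain \<beta> where "\<beta> \<in> elts \<delta>" "f ` I \<subseteq> elts \<beta>"
    using inacc unfolding inaccessible_def regular_cardinal_def by blast
  then show thesis
    using that by blast
qed

text \<open>Regularity gives one \<beta> < \<delta> into which all \<open>F i\<close> inject.
  Choosing for each point an index \<open>h u\<close> of a set containing it injects the union into
  the product of \<open>I\<close> and \<beta>.\<close>

lemma UN_lesspoll:
  fixes F :: "'b \<Rightarrow> 'c set"
  assumes "I \<prec> elts \<delta>" "\<And>i. i \<in> I \<Longrightarrow> F i \<prec> elts \<delta>"
  shows "(\<Union>i\<in>I. F i) \<prec> elts \<delta>"
proof -
  have "\<exists>\<alpha>. \<alpha> \<in> elts \<delta> \<and> F i \<lesssim> elts \<alpha>" if "i \<in> I" for i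
    using lesspoll_cardinal_bound[OF inaccessible_cardinal assms(2)[OF that]] by blast
  then obtain a where a: "\<And>i. i \<in> I \<Longrightarrow> a i \<in> elts \<delta> \<and> F i \<lesssim> elts (a i)"
    by metis
  obtain \<beta> where \<beta>: "\<beta> \<in> elts \<delta>" "\<And>i. i \<in> I \<Longrightarrow> a i \<in> elts \<beta>"
    using inaccessible_bounded[OF assms(1), of a] a by blast
  have "F i \<lesssim> elts \<beta>" if "i \<in> I" for i
    using a \<beta> that inaccessible_ordinal
    by (meson lepoll_trans ordinal_elem ordinal_trans subsetI subset_imp_lepoll)
  then obtain g where g: "\<And>i. i \<in> I \<Longrightarrow> inj_on (g i) (F i) \<and> g i ` F i \<subseteq> elts \<beta>"
    unfolding lepoll_def by metis
  define h where "h u = (SOME i. i \<in> I \<and> u \<in> F i)" for u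
  have h: "h u \<in> I \<and> u \<in> F (h u)" if "u \<in> (\<Union>i\<in>I. F i)" for u
    unfolding h_def by (rule someI_ex) (use that in blast)
  have "(\<Union>i\<in>I. F i) \<lesssim> I \<times> elts \<beta>"
    unfolding lepoll_def
  proof (intro exI conjI)
    show "inj_on (\<lambda>u. (h u, g (h u) u)) (\<Union>i\<in>I. F i)"
    proof (rule inj_onI)
      fix u v assume uv: "u \<in> (\<Union>i\<in>I. F i)" "v \<in> (\<Union>i\<in>I. F i)"
        and "(h u, g (h u) u) = (h v, g (h v) v)"
      then have "h u = h v" "g (h u) u = g (h u) v"
        by auto
      then show "u = v"
        using h[OF uv(1)] h[OF uv(2)] g[of "h u"] by (metis inj_onD)
    qed
    show "(\<lambda>u. (h u, g (h u) u)) ` (\<Union>i\<in>I. F i) \<subseteq> I \<times> elts \<beta>"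
      using g h by blast
  qed
  moreover have "I \<times> elts \<beta> \<prec> elts \<delta>"
    using Times_lesspoll assms(1) \<beta>(1) lepoll_elem_lesspoll by blast
  ultimately show ?thesis
    by (rule lesspoll_trans1)
qed

lemma nat_lesspoll: "(UNIV :: nat set) \<prec> elts \<delta>"
proof -
  have "uncountable (elts \<delta>)"
    using inacc by (simp add: inaccessible_def uncountable_cardinal_def)
  then have "\<not> elts \<delta> \<lesssim> (UNIV :: nat set)"
    using countable_lepoll[OF countableI_type] by blast
  then show ?thesis
    using not_lesspoll_iff by blast
qed

lemma Vset_lesspoll:
  assumes "\<alpha> \<in> elts \<delta>"
  shows "Vset \<alpha> \<prec> elts \<delta>"
  using assms
proof (induction \<alpha> rule: mem_induct)
  case (step \<alpha>)
  have "{x. elts x \<subseteq> Vset \<beta>} \<prec> elts \<delta>" if "\<beta> \<in> elts \<alpha>" for \<beta>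
  proof -
    have "Pow (Vset \<beta>) \<prec> elts \<delta>"
      using step that Pow_lesspoll inaccessible_ordinal ordinal_trans by blast
    moreover have "{x. elts x \<subseteq> Vset \<beta>} \<lesssim> Pow (Vset \<beta>)"
      unfolding lepoll_def by (rule exI[of _ elts]) (auto intro: inj_on_subset[OF inj_elts])
    ultimately show ?thesis
      using lesspoll_trans1 by blast
  qed
  moreover have "elts \<alpha> \<prec> elts \<delta>"
    using step.prems lepoll_elem_lesspoll by blast
  ultimately show ?case
    by (subst Vset.simps) (rule UN_lesspoll)
qed

text \<open>Take \<gamma> < \<delta> bounding both \<open>X\<close> and \<omega>. By Cantor's
  theorem a cardinal bounding the power set of \<gamma> is strictly larger than both, and the strong
  limit property keeps it below \<delta>.\<close>

lemma inaccessible_cardinal_above: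
  assumes "X \<prec> elts \<delta>"
  obtains \<kappa> where "\<kappa> \<in> elts \<delta>" "infinite_cardinal \<kappa>" "X \<prec> elts \<kappa>"
proof -
  obtain \<gamma> where \<gamma>: "\<gamma> \<in> elts \<delta>" "X \<lesssim> elts \<gamma>" "(UNIV :: nat set) \<lesssim> elts \<gamma>"
    using lesspoll_bound2[OF assms nat_lesspoll] .
  have "Pow (elts \<gamma>) \<prec> elts \<delta>"
    using \<gamma>(1) lepoll_elem_lesspoll Pow_lesspoll by blast
  then obtain \<alpha> where \<alpha>: "\<alpha> \<in> elts \<delta>" "Pow (elts \<gamma>) \<lesssim> elts \<alpha>"
    using lesspoll_cardinal_bound[OF inaccessible_cardinal] by blast
  obtain \<kappa> where \<kappa>: "cardinal \<kappa>" "Pow (elts \<gamma>) \<lesssim> elts \<kappa>" "\<kappa> \<in> elts (succ \<alpha>)"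
    using cardinal_above \<alpha> inaccessible_ordinal ordinal_elem by blast
  have "elts \<gamma> \<prec> elts \<kappa>"
    using \<kappa>(2) lesspoll_Pow_self lesspoll_trans2 by blast
  then have "X \<prec> elts \<kappa>" "(UNIV :: nat set) \<lesssim> elts \<kappa>"
    using \<gamma> lesspoll_trans1 lesspoll_imp_lepoll by blast+
  moreover have "\<kappa> \<in> elts \<delta>"
    using \<kappa>(3) \<alpha>(1) inaccessible_ordinal ordinal_trans by auto
  ultimately show thesis
    using that \<kappa>(1) infinite_le_lepoll unfolding infinite_cardinal_def by blast
qed

text \<open>Regularity bounds the levels at which fewer than \<delta> members appear.\<close>

lemma lesspoll_subset_Vset:
  assumes "X \<prec> elts \<delta>" "X \<subseteq> Vset \<delta>"
  obtains \<alpha> where "\<alpha> \<in> elts \<delta>" "X \<subseteq> Vset \<alpha>"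
proof -
  have "\<exists>\<beta>\<in>elts \<delta>. elts x \<subseteq> Vset \<beta>" if "x \<in> X" for x
    using assms(2) that mem_Vset_iff by blast
  then obtain b where b: "\<And>x. x \<in> X \<Longrightarrow> b x \<in> elts \<delta> \<and> elts x \<subseteq> Vset (b x)"
    by metis
  obtain \<alpha> where \<alpha>: "\<alpha> \<in> elts \<delta>" "\<And>x. x \<in> X \<Longrightarrow> b x \<in> elts \<alpha>"
    using inaccessible_bounded[OF assms(1), of b] b by blast
  have "X \<subseteq> Vset \<alpha>"
    using b \<alpha>(2) mem_Vset_iff by blast
  then show thesis
    using that \<alpha>(1) by blast
qed

end

section \<open>Rigid structures on ordinals\<close>

text \<open>For an ordinal \<gamma>, such an \<open>s\<close> is a strictly increasing
  \<omega>-sequence with supremum \<gamma>, so \<gamma> has cofinality \<omega>.\<close>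

definition ladder_to :: "'a::zfc_universe \<Rightarrow> (nat \<Rightarrow> 'a) \<Rightarrow> bool" where
  "ladder_to \<gamma> s \<longleftrightarrow> (\<forall>n. s n \<in> elts (s (Suc n))) \<and> elts \<gamma> = (\<Union>n. elts (s n))"

definition ladder :: "'a::zfc_universe \<Rightarrow> nat \<Rightarrow> 'a" where
  "ladder \<gamma> = (SOME s. ladder_to \<gamma> s)"

text \<open>The existence clause excludes those \<gamma> for which \<open>ladder \<gamma>\<close> is
  an arbitrary value. A map preserving these relations therefore sends points with a ladder to
  points with a ladder.\<close>

definition ladder_step :: "nat \<Rightarrow> 'a::zfc_universe \<Rightarrow> 'a \<Rightarrow> bool" where
  "ladder_step n \<beta> \<gamma> \<longleftrightarrow> (\<exists>s. ladder_to \<gamma> s) \<and> \<beta> = ladder \<gamma> n"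

lemma ladder_to_ladder: "ladder_to \<gamma> s \<Longrightarrow> ladder_to \<gamma> (ladder \<gamma>)"
  unfolding ladder_def by (rule someI[where P = "ladder_to \<gamma>"])

lemma ladder_to_mem: "ladder_to \<gamma> s \<Longrightarrow> s n \<in> elts \<gamma>"
  unfolding ladder_to_def by blast

text \<open>Iterating \<open>j\<close> at a moved point \<open>a\<close> yields an \<open>\<omega>\<close>-sequence whose supremum \<open>\<gamma>\<close> is fixed.
  Hence the ladder of \<open>\<gamma>\<close> is fixed pointwise, so \<open>j\<close> has a fixed point between \<open>a\<close> and \<open>\<gamma>\<close>, above
  which the iteration can never get.\<close>

lemma ladder_rigid:
  fixes \<alpha> :: "'a::zfc_universe"
  assumes \<alpha>: "ordinal \<alpha>"
    and j: "\<And>x. x \<in> elts (succ \<alpha>) \<Longrightarrow> j x \<in> elts (succ \<alpha>)"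
    and mono: "\<And>x y. x \<in> elts (succ \<alpha>) \<Longrightarrow> y \<in> elts (succ \<alpha>) \<Longrightarrow> x \<in> elts y \<Longrightarrow> j x \<in> elts (j y)"
    and lad: "\<And>n x y. x \<in> elts (succ \<alpha>) \<Longrightarrow> y \<in> elts (succ \<alpha>) \<Longrightarrow> ladder_step n x y \<Longrightarrow>
      ladder_step n (j x) (j y)"
    and x: "x \<in> elts (succ \<alpha>)"
  shows "j x = x"
proof (rule ccontr)
  define W where "W = elts (succ \<alpha>)"
  note j = j[folded W_def] and mono = mono[folded W_def] and lad = lad[folded W_def]
  have W_ord: "ordinal y" if "y \<in> W" for y
    using that \<alpha> ordinal_succ ordinal_elem unfolding W_def by blast
  have W_trans: "z \<in> W" if "y \<in> W" "z \<in> elts y" for y z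
    using that ordinal_trans[OF ordinal_succ[OF \<alpha>]] unfolding W_def by blast
  \<comment> \<open>If \<open>j m\<close> is below \<open>m\<close> for a least \<open>m\<close>,
    then monotonicity makes \<open>j m\<close> a smaller point of this kind.\<close>
  have incr: "elts y \<subseteq> elts (j y)" if "y \<in> W" for y
  proof (rule ccontr)
    assume "\<not> elts y \<subseteq> elts (j y)"
    then have "y \<in> {y \<in> W. j y \<in> elts y}"
      using that W_ord j ordinal_not_mem_iff by blast
    then obtain m where "m \<in> {y \<in> W. j y \<in> elts y}"
      and "\<And>z. z \<in> elts m \<Longrightarrow> z \<notin> {y \<in> W. j y \<in> elts y}"
      by (rule mem_minimal) blast
    then show False
      using mono j by blast
  qed
  assume "j x \<noteq> x"
  define a where "a = x"
  have a: "a \<in> W" "j a \<noteq> a"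
    using x \<open>j x \<noteq> x\<close> by (auto simp: W_def a_def)
  then have a_j: "a \<in> elts (j a)"
    by (metis incr[OF a(1)] W_ord[OF a(1)] W_ord[OF j[OF a(1)]] mem_irrefl ordinal_linear subsetD)
  define s where "s n = (j ^^ n) a" for n
  have s_W: "s n \<in> W" for n
    by (induction n) (auto simp: s_def a j)
  have s_Suc: "s (Suc n) = j (s n)" for n
    by (simp add: s_def)
  have s_mem: "s n \<in> elts (s (Suc n))" for n
  proof (induction n)
    case 0
    then show ?case
      using a_j by (simp add: s_def)
  next
    case (Suc n)
    then show ?case
      using mono s_W by (simp only: s_Suc[of n] s_Suc[of "Suc n"]) (metis s_Suc)
  qed
  define \<gamma> where "\<gamma> = mkset (\<Union>(elts ` range s))"
  have \<gamma>: "ordinal \<gamma>" "elts \<gamma> = (\<Union>n. elts (s n))"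
    using ordinal_UN[of "range s"] small_range_nat[of s] s_W W_ord unfolding \<gamma>_def by auto
  have "elts \<gamma> \<subseteq> elts \<alpha>"
    using s_W \<alpha> unfolding \<gamma>(2) W_def elts_succ by (metis UN_least insertE ordinal_trans subsetI)
  \<comment> \<open>The supremum \<gamma> may be \<alpha> itself, which is why the map is considered
    on \<alpha> + 1.\<close>
  then have \<gamma>W: "\<gamma> \<in> W"
    unfolding W_def elts_succ
    by (metis \<alpha> \<gamma>(1) insert_iff ordinal_linear ordinal_not_mem_iff)
  have "ladder_to \<gamma> s"
    using s_mem \<gamma>(2) by (simp add: ladder_to_def)
  then have t: "ladder_to \<gamma> (ladder \<gamma>)"
    by (rule ladder_to_ladder)
  define t where "t = ladder \<gamma>"
  have tW: "t n \<in> W" for n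
    using ladder_to_mem[OF t] W_trans[OF \<gamma>W] by (simp add: t_def)
  have "ladder_step n (t n) \<gamma>" for n
    using t unfolding ladder_step_def t_def by blast
  then have "ladder_step n (j (t n)) (j \<gamma>)" for n
    using lad tW \<gamma>W by blast
  then have jt: "ladder_to (j \<gamma>) (ladder (j \<gamma>))" "\<And>n. j (t n) = ladder (j \<gamma>) n"
    unfolding ladder_step_def using ladder_to_ladder by blast+
  \<comment> \<open>Some \<open>s m\<close> is above \<open>t n\<close>, so the image of
    \<open>t n\<close> is below \<open>s (Suc m)\<close>. These images form the ladder of
    \<open>j \<gamma>\<close>, whence \<open>j \<gamma>\<close> \<le> \<gamma>.\<close>
  have "j (t n) \<in> elts \<gamma>" for n
  proof -
    obtain m where "t n \<in> elts (s m)"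
      using ladder_to_mem[OF t, of n] unfolding \<gamma>(2) t_def by blast
    then have "j (t n) \<in> elts (s (Suc m))"
      using mono[OF tW s_W] by (simp add: s_Suc)
    then show ?thesis
      using \<gamma>(2) by blast
  qed
  then have "elts (j \<gamma>) \<subseteq> elts \<gamma>"
    using jt \<gamma>(1) ordinal_trans unfolding ladder_to_def by fastforce
  then have "j \<gamma> = \<gamma>"
    using incr[OF \<gamma>W] extensionality by blast
  then have t_fixed: "j (t n) = t n" for n
    using jt(2) by (simp add: t_def)
  have "a \<in> elts \<gamma>"
    using a_j unfolding \<gamma>(2) by (intro UN_I[of 1]) (auto simp: s_def)
  then obtain n where n: "a \<in> elts (t n)"
    using t unfolding ladder_to_def t_def by blast
  have s_t: "s m \<in> elts (t n)" for m
  proof (induction m)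
    case 0
    then show ?case
      using n by (simp add: s_def)
  next
    case (Suc m)
    then show ?case
      using mono[OF s_W tW] by (metis s_Suc t_fixed)
  qed
  obtain m where "t n \<in> elts (s m)"
    using ladder_to_mem[OF t, of n] unfolding \<gamma>(2) t_def by blast
  then show False
    using s_t mem_asym by blast
qed

section \<open>Structures with countably many binary relations, coded as sets\<close>

definition binary_language :: "'a::zfc_universe language" where
  "binary_language = \<lparr>rels = range ord_of_nat, funs = {}, rel_arity = \<lambda>_. 2, fun_arity = \<lambda>_. 0\<rparr>"

definition graph_set :: "'a::zfc_universe \<Rightarrow> ('a \<Rightarrow> 'a \<Rightarrow> bool) \<Rightarrow> 'a" where
  "graph_set D P = mkset {tuple [x, y] |x y. x \<in> elts D \<and> y \<in> elts D \<and> P x y}"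

definition binary_structure ::
    "'a::zfc_universe \<Rightarrow> (nat \<Rightarrow> 'a \<Rightarrow> 'a \<Rightarrow> bool) \<Rightarrow> 'a" where
  "binary_structure D P =
     pair D (pair (mkset (range (\<lambda>n. pair (ord_of_nat n) (graph_set D (P n))))) (mkset {}))"

lemma tuple2: "tuple [x, y] = mkset {pair (ord_of_nat 0) x, pair (ord_of_nat 1) y}"
proof -
  have *: "{i. i < length [x, y]} = {0, 1}"
    by auto
  have "{pair (ord_of_nat i) ([x, y] ! i) |i. i < length [x, y]} =
      {pair (ord_of_nat 0) x, pair (ord_of_nat 1) y}"
    unfolding setcompr_eq_image * by simp
  then show ?thesis
    unfolding tuple_def by (simp only:)
qed

lemma tuple2_eq_iff [simp]: "tuple [x, y] = tuple [x', y'] \<longleftrightarrow> x = x' \<and> y = y'"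
  unfolding tuple2 using ord_of_nat_eq_iff[of 0 1]
  by (auto simp: mkset_eq_iff doubleton_eq_iff simp del: ord_of_nat.simps)

lemma elts_graph_set:
  "elts (graph_set D P) = {tuple [x, y] |x y. x \<in> elts D \<and> y \<in> elts D \<and> P x y}"
proof -
  have "small (\<Union>x\<in>elts D. (\<lambda>y. tuple [x, y]) ` elts D)"
    by (intro small_UN small_image small_elts)
  then show ?thesis
    unfolding graph_set_def by (intro elts_mkset) (erule small_subset, auto)
qed

lemma domain_binary_structure [simp]: "domain (binary_structure D P) = elts D"
  by (simp add: binary_structure_def)

lemma rel_interp_binary_structure:
  "rel_interp (binary_structure D P) (ord_of_nat n) = graph_set D (P n)"
  unfolding rel_interp_def app_def binary_structure_def
  by (rule the_equality) (auto simp: small_range_nat)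

lemma is_structure_binary_structure:
  assumes "elts D \<noteq> {}"
  shows "is_structure binary_language (binary_structure D P)"
proof -
  have "function_on (mkset (range (\<lambda>n. pair (ord_of_nat n) (graph_set D (P n)))))
      (range (ord_of_nat :: nat \<Rightarrow> 'a))"
    by (auto simp: function_on_def small_range_nat)
  moreover have "function_on (mkset {}) ({} :: 'a set)"
    by (simp add: function_on_def)
  moreover have "elts (graph_set D (P n)) \<subseteq> tuples (elts D) 2" for n
  proof
    fix z assume "z \<in> elts (graph_set D (P n))"
    then obtain x y where "z = tuple [x, y]" "x \<in> elts D" "y \<in> elts D"
      by (auto simp: elts_graph_set)
    then show "z \<in> tuples (elts D) 2"
      unfolding tuples_def by (intro CollectI exI[of _ "[x, y]"]) auto
  qed
  ultimately show ?thesis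
    unfolding is_structure_def using assms
    by (auto simp: binary_language_def rel_interp_binary_structure)
      (auto simp: binary_structure_def)
qed

text \<open>Only atomic formulas in two variables are used; they are both preserved and
  reflected.\<close>

lemma elementary_embedding_binary_structure:
  assumes "elementary_embedding binary_language j (binary_structure D P) (binary_structure D' P')"
    and xy: "x \<in> elts D" "y \<in> elts D"
  shows "j x \<in> elts D'" "P n x y \<longleftrightarrow> P' n (j x) (j y)"
proof -
  have jD: "j z \<in> elts D'" if "z \<in> elts D" for z
    using assms(1) that by (auto simp: elementary_embedding_def)
  then show "j x \<in> elts D'"
    using xy by blast
  define v where "v = (\<lambda>i::nat. if i = 0 then x else y)"
  let ?\<phi> = "Rel (ord_of_nat n) [Var 0, Var 1]"
  have "range v \<subseteq> domain (binary_structure D P)" "wf_fm binary_language ?\<phi>"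
    using xy by (auto simp: v_def binary_language_def)
  then have "sat (binary_structure D P) v ?\<phi> \<longleftrightarrow> sat (binary_structure D' P') (j \<circ> v) ?\<phi>"
    using assms(1) unfolding elementary_embedding_def by blast
  then show "P n x y \<longleftrightarrow> P' n (j x) (j y)"
    using xy jD[OF xy(1)] jD[OF xy(2)]
    by (simp add: rel_interp_binary_structure elts_graph_set v_def)
qed

lemma binary_structure_mem_Vset:
  fixes \<delta> :: "'a::zfc_universe"
  assumes "uncountable_cardinal \<delta>" "x \<in> elts \<delta>"
  shows "binary_structure x P \<in> Vset \<delta>"
proof -
  have \<delta>: "infinite_cardinal \<delta>" "ordinal \<delta>"
    using assms(1) countable_finite
    unfolding uncountable_cardinal_def infinite_cardinal_def cardinal_def by blast+
  define \<omega> :: 'a where "\<omega> = mkset (range ord_of_nat)"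
  have \<omega>: "ordinal \<omega>" "elts \<omega> = range ord_of_nat"
    unfolding \<omega>_def by (auto simp: ordinal_omega small_range_ord_of_nat)
  \<comment> \<open>Uncountability puts \<omega> below \<delta>, so that one level below \<delta>
    contains all relation symbols.\<close>
  have "\<not> elts \<delta> \<subseteq> elts \<omega>"
    using assms(1) countable_subset[of "elts \<delta>" "range ord_of_nat"]
    unfolding \<omega>(2) uncountable_cardinal_def by auto
  then have "\<omega> \<in> elts \<delta>"
    using \<delta>(2) \<omega>(1) ordinal_not_mem_iff by blast
  then obtain \<beta> where \<beta>: "\<beta> \<in> elts \<delta>" "elts x \<subseteq> elts \<beta>" "elts \<omega> \<subseteq> elts \<beta>"
    using that[of x] that[of \<omega>] assms(2) ordinal_linear[of x \<omega>] ordinal_elem[OF \<delta>(2)]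
      ordinal_trans by blast
  have ord: "ordinal ((succ ^^ n) \<beta>)" and mem: "(succ ^^ n) \<beta> \<in> elts \<delta>" for n
    by (induction n) (use \<beta> \<delta> ordinal_elem in \<open>auto intro: ordinal_succ infinite_cardinal_limit\<close>)
  have up: "Vset ((succ ^^ n) \<beta>) \<subseteq> Vset ((succ ^^ (n + k)) \<beta>)" for n k
  proof (rule Vset_mono)
    show "elts ((succ ^^ n) \<beta>) \<subseteq> elts ((succ ^^ (n + k)) \<beta>)"
      by (induction k) auto
  qed
  \<comment> \<open>Ranks are counted from \<beta>: \<open>mkset\<close> costs one level and
    \<open>pair\<close> two. The whole structure appears after eleven levels, still below the limit
    \<delta>.\<close>
  define U where "U n = Vset ((succ ^^ n) \<beta>)" for n
  have U_mono: "u \<in> U m" if "u \<in> U n" "n \<le> m" for u n m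
    using up[of n "m - n"] that by (auto simp: U_def)
  have U_mkset: "mkset X \<in> U (Suc n)" if "small X" "X \<subseteq> U n" for X n
    using mkset_subset_Vset[OF ord that(1)] that(2) by (simp add: U_def)
  have U_pair: "pair u v \<in> U (Suc (Suc n))" if "u \<in> U n" "v \<in> U n" for u v n
    using pair_mem_Vset[OF ord] that by (simp add: U_def)
  have elts_U: "elts x \<subseteq> U 0" and nat_U: "ord_of_nat n \<in> U 0" for n
    using \<beta> ordinal_subset_Vset \<omega>(2) by (auto simp: U_def)
  have "tuple [u, v] \<in> U 3" if "u \<in> elts x" "v \<in> elts x" for u v
  proof -
    have "pair (ord_of_nat 0) u \<in> U 2" "pair (ord_of_nat 1) v \<in> U 2"
      using U_pair[of _ 0] elts_U nat_U that by (auto simp: numeral_2_eq_2 simp del: ord_of_nat.simps)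
    then show ?thesis
      unfolding tuple2 using U_mkset[of _ 2] by (simp add: numeral_3_eq_3 numeral_2_eq_2)
  qed
  then have "elts (graph_set x (P n)) \<subseteq> U 3" for n
    by (auto simp: elts_graph_set)
  then have "graph_set x (P n) \<in> U 4" for n
    using U_mkset[of "elts (graph_set x (P n))" 3] by simp
  then have "pair (ord_of_nat n) (graph_set x (P n)) \<in> U 6" for n
    using U_pair[of _ 4] U_mono[OF nat_U, of 4] by simp
  then have "mkset (range (\<lambda>n. pair (ord_of_nat n) (graph_set x (P n)))) \<in> U 7"
    using U_mkset[OF small_range_nat[of "\<lambda>n. pair (ord_of_nat n) (graph_set x (P n))"], of 6]
    by (simp add: image_subset_iff)
  moreover have "mkset {} \<in> U 7"
    using U_mkset[of "{}" 6] by simp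
  ultimately have "pair (mkset (range (\<lambda>n. pair (ord_of_nat n) (graph_set x (P n))))) (mkset {}) \<in> U 9"
    using U_pair[of _ 7] by simp
  moreover have "x \<in> U 9"
    using U_mkset[of "elts x" 0] elts_U U_mono[of x 1 9] by simp
  ultimately have "binary_structure x P \<in> U 11"
    unfolding binary_structure_def using U_pair[of _ 9] by simp
  then show ?thesis
    using Vset_mono_mem[OF \<delta>(2) mem] unfolding U_def by blast
qed

text \<open>Symbol 0 is membership on \<alpha> + 1, the symbols 1 and 2 mark \<alpha> + 1 and
  \<open>S\<close> on the diagonal, and symbol \<open>n + 3\<close> is the \<open>n\<close>-th
  ladder relation. For \<open>S\<close> below \<alpha>, the points of \<open>x\<close> outside
  \<alpha> + 1 carry no relation and only provide size.\<close>

definition coded_structure :: "'a::zfc_universe \<Rightarrow> 'a set \<Rightarrow> 'a \<Rightarrow> 'a" where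
  "coded_structure \<alpha> S x = binary_structure x (\<lambda>n u v.
     if n = 0 then u \<in> elts (succ \<alpha>) \<and> v \<in> elts (succ \<alpha>) \<and> u \<in> elts v
     else if n = 1 then u = v \<and> u \<in> elts (succ \<alpha>)
     else if n = 2 then u = v \<and> u \<in> S
     else u \<in> elts (succ \<alpha>) \<and> v \<in> elts (succ \<alpha>) \<and> ladder_step (n - 3) u v)"

lemma domain_coded_structure [simp]: "domain (coded_structure \<alpha> S x) = elts x"
  by (simp add: coded_structure_def)

text \<open>Symbol 1 keeps \<alpha> + 1 invariant under \<open>j\<close>; membership and ladders
  then force \<open>j\<close> to be the identity there, so symbol 2 shows that \<open>S\<close> and
  \<open>S'\<close> agree.\<close>

lemma coded_structure_rigid:
  assumes \<alpha>: "ordinal \<alpha>" and S: "S \<subseteq> elts \<alpha>" "S' \<subseteq> elts \<alpha>"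
    and x: "elts (succ \<alpha>) \<subseteq> elts x"
    and j: "elementary_embedding binary_language j (coded_structure \<alpha> S x) (coded_structure \<alpha> S' y)"
  shows "S = S'"
proof -
  note emb = elementary_embedding_binary_structure(2)[OF j[unfolded coded_structure_def]]
  note emb_x = emb[OF subsetD[OF x] subsetD[OF x]]
  have fixed: "j u = u" if u: "u \<in> elts (succ \<alpha>)" for u
  proof (rule ladder_rigid[OF \<alpha> _ _ _ u])
    show "j u \<in> elts (succ \<alpha>)" if "u \<in> elts (succ \<alpha>)" for u
      using emb_x[of u u 1] that by simp
    show "j u \<in> elts (j v)" if "u \<in> elts (succ \<alpha>)" "v \<in> elts (succ \<alpha>)" "u \<in> elts v" for u v
      using emb_x[of u v 0] that by simp
    show "ladder_step n (j u) (j v)"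
      if "u \<in> elts (succ \<alpha>)" "v \<in> elts (succ \<alpha>)" "ladder_step n u v" for n u v
      using emb_x[of u v "n + 3"] that by simp
  qed
  have "u \<in> S \<longleftrightarrow> u \<in> S'" if "u \<in> elts \<alpha>" for u
    using emb_x[of u u 2] fixed[of u] that by simp
  then show ?thesis
    using S by blast
qed

text \<open>Both a short cofinal subset of \<open>\<delta>\<close> and, if the power set of \<open>\<alpha>\<close> is large, \<open>\<delta>\<close> itself qualify as \<open>X\<close>.\<close>

lemma no_reflection:
  fixes \<delta> :: "'a::zfc_universe"
  assumes \<delta>: "uncountable_cardinal \<delta>" and \<alpha>: "\<alpha> \<in> elts \<delta>"
    and X: "X \<subseteq> elts \<delta>" "\<And>\<beta>. \<beta> \<in> elts \<delta> \<Longrightarrow> \<not> X \<subseteq> elts \<beta>" "X \<lesssim> Pow (elts \<alpha>)"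
  obtains C where "structures_of_type binary_language (elts C)" "C \<in> Vset (succ \<delta>) - Vset \<delta>"
    "\<And>\<kappa>. \<kappa> \<in> elts \<delta> \<Longrightarrow> \<not> SR binary_language (elts C) \<kappa>"
    "\<And>\<kappa>. \<kappa> \<in> elts \<delta> \<Longrightarrow> \<not> VSR binary_language (elts C) \<kappa>"
proof -
  have ord: "ordinal \<delta>" "infinite_cardinal \<delta>"
    using \<delta> countable_finite
    unfolding uncountable_cardinal_def infinite_cardinal_def cardinal_def by blast+
  have ord_mem: "ordinal \<beta>" if "\<beta> \<in> elts \<delta>" for \<beta>
    using ord(1) that ordinal_elem by blast
  obtain S where S: "inj_on S X" "S ` X \<subseteq> Pow (elts \<alpha>)"
    using X(3) unfolding lepoll_def by blast
  \<comment> \<open>Beyond \<alpha> each \<open>x\<close> contains \<alpha> + 1, as rigidity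
    requires. Distinct members of \<open>Y\<close> code distinct subsets of \<alpha>.\<close>
  define Y where "Y = {x \<in> X. \<alpha> \<in> elts x}"
  define B where "B x = coded_structure \<alpha> (S x) x" for x
  have unbounded: "\<exists>x\<in>Y. \<beta> \<in> elts x" if \<beta>: "\<beta> \<in> elts \<delta>" for \<beta>
  proof -
    \<comment> \<open>The larger of \<alpha> and \<beta>.\<close>
    obtain \<mu> where \<mu>: "\<mu> \<in> elts \<delta>" "\<alpha> \<in> elts (succ \<mu>)" "\<beta> \<in> elts (succ \<mu>)"
      using that[of \<alpha>] that[of \<beta>] \<alpha> \<beta> ordinal_linear[OF ord_mem[OF \<alpha>] ord_mem[OF \<beta>]] by auto
    then obtain x where x: "x \<in> X" "x \<notin> elts (succ \<mu>)"
      using X(2) infinite_cardinal_limit[OF ord(2)] by blast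
    then have "elts (succ \<mu>) \<subseteq> elts x"
      using X(1) ord_mem \<mu>(1) ordinal_not_mem_iff ordinal_succ by blast
    then show ?thesis
      using x(1) \<mu> by (auto simp: Y_def)
  qed
  have emb_eq: "y = x" if "x \<in> Y" "y \<in> Y" "elementary_embedding binary_language j (B y) (B x)" for x y j
  proof -
    have "elts (succ \<alpha>) \<subseteq> elts y"
      using that(2) X(1) ord_mem[of y] by (auto simp: Y_def intro: ordinal_trans)
    then have "S y = S x"
      using coded_structure_rigid[of \<alpha> "S y" "S x" y j x] ord_mem[OF \<alpha>] S(2) that
      unfolding Y_def B_def by blast
    then show ?thesis
      using S(1) that(1,2) inj_onD unfolding Y_def by fastforce
  qed
  define C where "C = mkset (B ` Y)"
  have "small Y"
    by (rule small_subset[of "elts \<delta>"]) (use X(1) in \<open>auto simp: Y_def\<close>)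
  then have C: "elts C = B ` Y"
    unfolding C_def by (simp add: small_image)
  show thesis
  proof
    have "is_structure binary_language (B x)" if "x \<in> Y" for x
      using that is_structure_binary_structure[of x] unfolding Y_def B_def coded_structure_def by blast
    moreover have "countable_language (binary_language :: 'a language)"
      by (simp add: countable_language_def binary_language_def)
    ultimately show "structures_of_type binary_language (elts C)"
      by (auto simp: structures_of_type_def C)
    have "B x \<in> Vset \<delta>" if "x \<in> Y" for x
      using that X(1) binary_structure_mem_Vset[OF \<delta>] unfolding Y_def B_def coded_structure_def by blast
    then have "elts C \<subseteq> Vset \<delta>"
      by (auto simp: C)
    \<comment> \<open>The domain \<open>x\<close> contains \<beta>, and \<beta> is not in
      \<open>Vset \<beta>\<close>.\<close>
    have rank_B: "B x \<notin> Vset \<beta>" if "\<beta> \<in> elts \<delta>" "x \<in> Y" "\<beta> \<in> elts x" for x \<beta>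
    proof
      assume "B x \<in> Vset \<beta>"
      then have "domain (B x) \<subseteq> Vset \<beta>"
        using domain_subset_Vset ord_mem[OF that(1)]
        unfolding B_def coded_structure_def binary_structure_def by blast
      then have "\<beta> \<in> Vset \<beta>"
        using that(3) by (auto simp: B_def)
      then show False
        using ordinal_mem_Vset ord_mem[OF that(1)] mem_irrefl by blast
    qed
    then have "\<not> elts C \<subseteq> Vset \<beta>" if "\<beta> \<in> elts \<delta>" for \<beta>
      using unbounded[OF that] that by (auto simp: C)
    then show "C \<in> Vset (succ \<delta>) - Vset \<delta>"
      using \<open>elts C \<subseteq> Vset \<delta>\<close> mem_Vset_succ_iff[OF ord(1)] mem_Vset_iff[of C] by blast
    fix \<kappa> assume \<kappa>: "\<kappa> \<in> elts \<delta>"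
    \<comment> \<open>Only \<open>B x\<close> itself embeds into \<open>B x\<close>, and for
      \<open>x\<close> above \<kappa> it is neither of size below \<kappa> nor in
      \<open>Vset \<kappa>\<close>.\<close>
    obtain x where x: "x \<in> Y" "\<kappa> \<in> elts x"
      using unbounded[OF \<kappa>] by blast
    then have "B x \<in> elts C"
      by (simp add: C)
    have unique: "A = B x" if "A \<in> elts C" "elementary_embedding binary_language j A (B x)" for A j
      using that emb_eq[OF x(1)] by (auto simp: C)
    have "elts \<kappa> \<subseteq> elts x"
      using x X(1) ord_mem[of x] ordinal_trans by (auto simp: Y_def)
    then have "\<not> domain (B x) \<prec> elts \<kappa>"
      by (simp add: B_def not_lesspoll_iff subset_imp_lepoll)
    then show "\<not> SR binary_language (elts C) \<kappa>"
      using unique \<open>B x \<in> elts C\<close> unfolding SR_def by metis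
    show "\<not> VSR binary_language (elts C) \<kappa>"
      using unique \<open>B x \<in> elts C\<close> rank_B[OF \<kappa> x] unfolding VSR_def by (metis IntE)
  qed
qed

text \<open>Reflection bounds every subset of \<delta> that injects into the power set of some
  \<alpha> < \<delta>. For subsets of size below \<delta> this is regularity; for \<delta> itself it
  is absurd, which gives the strong limit property.\<close>

lemma reflection_imp_inaccessible:
  fixes \<delta> :: "'a::zfc_universe"
  assumes \<delta>: "uncountable_cardinal \<delta>"
    and refl: "\<And>C. structures_of_type binary_language (elts C) \<Longrightarrow> C \<in> Vset (succ \<delta>) - Vset \<delta> \<Longrightarrow>
      \<exists>\<kappa>\<in>elts \<delta>. SR binary_language (elts C) \<kappa> \<or> VSR binary_language (elts C) \<kappa>"
  shows "inaccessible \<delta>"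
proof -
  have card: "cardinal \<delta>" "infinite_cardinal \<delta>"
    using \<delta> countable_finite
    unfolding uncountable_cardinal_def infinite_cardinal_def by blast+
  have bounded: "\<exists>\<beta>\<in>elts \<delta>. X \<subseteq> elts \<beta>"
    if "X \<subseteq> elts \<delta>" "\<alpha> \<in> elts \<delta>" "X \<lesssim> Pow (elts \<alpha>)" for X \<alpha>
    using no_reflection[OF \<delta> that(2,1) _ that(3)] refl by metis
  have "\<exists>\<beta>\<in>elts \<delta>. X \<subseteq> elts \<beta>" if X: "X \<subseteq> elts \<delta>" "X \<prec> elts \<delta>" for X
  proof -
    obtain \<alpha> where "\<alpha> \<in> elts \<delta>" "X \<lesssim> elts \<alpha>"
      using lesspoll_cardinal_bound[OF card(1) X(2)] .
    then show ?thesis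
      using bounded[OF X(1)] lepoll_Pow_self lepoll_trans by blast
  qed
  moreover have "Pow (elts \<alpha>) \<prec> elts \<delta>" if \<alpha>: "\<alpha> \<in> elts \<delta>" for \<alpha>
  proof (rule ccontr)
    assume "\<not> Pow (elts \<alpha>) \<prec> elts \<delta>"
    then obtain \<beta> where "\<beta> \<in> elts \<delta>" "elts \<delta> \<subseteq> elts \<beta>"
      using bounded[OF subset_refl \<alpha>] not_lesspoll_iff by blast
    then show False
      using mem_irrefl by blast
  qed
  ultimately show ?thesis
    using \<delta> card
    unfolding inaccessible_def regular_cardinal_def strong_limit_cardinal_def by blast
qed

section \<open>Counting structures\<close>

instance tm :: (countable) countable
  by countable_datatype

instance fm :: (countable) countable
  by countable_datatype

lemma wf_tm_symbols: "wf_tm L t \<Longrightarrow> set_tm t \<subseteq> funs L"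
  by (induction t) (auto simp: list_all_iff)

lemma wf_fm_symbols: "wf_fm L \<phi> \<Longrightarrow> set_fm \<phi> \<subseteq> rels L \<union> funs L"
  by (induction \<phi>) (auto simp: list_all_iff dest!: wf_tm_symbols)

text \<open>The type of symbols may be uncountable, but the formulas of \<open>L\<close> use symbols
  from a countable set. Renaming these injectively by natural numbers embeds the formulas into a
  countable type.\<close>

lemma countable_wf_fm:
  assumes "countable_language L"
  shows "countable {\<phi>. wf_fm L \<phi>}"
proof -
  let ?S = "rels L \<union> funs L"
  have "countable ?S"
    using assms by (simp add: countable_language_def)
  then have "inj_on (to_nat_on ?S) ?S"
    by (rule inj_on_to_nat_on)
  then have "inj_on (map_fm (to_nat_on ?S)) {\<phi>. wf_fm L \<phi>}"
    by (intro inj_onI fm.inj_map_strong[of _ _ "to_nat_on ?S" "to_nat_on ?S"])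
      (auto dest!: wf_fm_symbols inj_onD)
  then show ?thesis
    by (rule countable_image_inj_on[rotated]) simp
qed

text \<open>The full theory of \<open>A\<close>, read along an injection \<open>f\<close> of its domain into a fixed ordinal.\<close>

definition theory_code ::
    "'a::zfc_universe language \<Rightarrow> 'a \<Rightarrow> ('a \<Rightarrow> 'a) \<Rightarrow> ('a fm \<times> (nat \<Rightarrow> 'a)) set" where
  "theory_code L A f = {(\<phi>, f \<circ> v) |\<phi> v. wf_fm L \<phi> \<and> range v \<subseteq> domain A \<and> sat A v \<phi>}"

text \<open>The embedding is \<open>f\<close> followed by the inverse of \<open>g\<close>. An
  assignment and its image under this map have the same code, so equality of the codes transfers
  satisfaction.\<close>

lemma theory_code_embedding:
  assumes f: "inj_on f (domain A)" and g: "inj_on g (domain B)"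
    and eq: "theory_code L A f = theory_code L B g"
  shows "\<exists>j. elementary_embedding L j A B"
proof -
  \<comment> \<open>Injectivity of \<open>h\<close> on the domain recovers the assignment
    \<open>v\<close> from \<open>h \<circ> v\<close>.\<close>
  have code_iff: "(\<phi>, h \<circ> v) \<in> theory_code L M h \<longleftrightarrow> sat M v \<phi>"
    if "inj_on h (domain M)" "range v \<subseteq> domain M" "wf_fm L \<phi>" for \<phi> v M h
  proof
    assume "(\<phi>, h \<circ> v) \<in> theory_code L M h"
    then obtain w where w: "h \<circ> v = h \<circ> w" "range w \<subseteq> domain M" "sat M w \<phi>"
      by (auto simp: theory_code_def)
    then have "v = w"
      using that(1,2) by (metis UNIV_I comp_apply ext image_subset_iff inj_onD)
    then show "sat M v \<phi>"
      using w(3) by simp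
  qed (use that in \<open>auto simp: theory_code_def\<close>)
  \<comment> \<open>A formula true under every assignment: through constant assignments the code
    records the image of the domain.\<close>
  let ?\<phi> = "Eq (Var 0) (Var 0) :: 'a fm"
  have "f ` domain A \<subseteq> g ` domain B"
  proof
    fix d assume "d \<in> f ` domain A"
    then obtain a where a: "a \<in> domain A" "d = f a"
      by blast
    define c where "c = f \<circ> (\<lambda>_::nat. a)"
    have "(?\<phi>, c) \<in> theory_code L B g"
      unfolding c_def eq[symmetric] using a by (subst code_iff[OF f]) auto
    then obtain w where "c = g \<circ> w" "range w \<subseteq> domain B"
      by (auto simp: theory_code_def)
    then show "d \<in> g ` domain B"
      using a(2) unfolding c_def by (metis UNIV_I comp_apply image_eqI image_subset_iff)
  qed
  define j where "j = inv_into (domain B) g \<circ> f"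
  have j: "j a \<in> domain B" "g (j a) = f a" if "a \<in> domain A" for a
    using that \<open>f ` domain A \<subseteq> g ` domain B\<close> unfolding j_def
    by (auto simp: f_inv_into_f image_subset_iff inv_into_into)
  have "elementary_embedding L j A B"
    unfolding elementary_embedding_def
  proof (intro conjI allI impI)
    show "j ` domain A \<subseteq> domain B"
      using j by blast
    fix \<phi> and v :: "nat \<Rightarrow> 'a" assume *: "wf_fm L \<phi> \<and> range v \<subseteq> domain A"
    then have "f \<circ> v = g \<circ> (j \<circ> v)"
      using j(2) by (auto simp: fun_eq_iff image_subset_iff)
    moreover have "range (j \<circ> v) \<subseteq> domain B"
      using * j(1) by auto
    ultimately show "sat A v \<phi> \<longleftrightarrow> sat B (j \<circ> v) \<phi>"
      using * code_iff[OF f, of v \<phi>] code_iff[OF g, of "j \<circ> v" \<phi>] eq by simp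
  qed
  then show ?thesis
    by blast
qed

text \<open>Equal codes give embeddings, and there are fewer than \<delta> codes. Keeping one
  structure for each code leaves a set that regularity confines to a level below \<delta>.\<close>

lemma Vset_representatives:
  fixes \<delta> :: "'a::zfc_universe"
  assumes \<delta>: "inaccessible \<delta>" and L: "countable_language L"
    and C: "C \<subseteq> Vset \<delta>" and \<kappa>: "\<kappa> \<in> elts \<delta>"
  obtains \<alpha> where "\<alpha> \<in> elts \<delta>"
    "\<And>B. B \<in> C \<Longrightarrow> domain B \<lesssim> elts \<kappa> \<Longrightarrow> \<exists>A\<in>C \<inter> Vset \<alpha>. \<exists>j. elementary_embedding L j A B"
proof -
  define C' where "C' = {B \<in> C. domain B \<lesssim> elts \<kappa>}"
  define f where "f B = (SOME f. inj_on f (domain B) \<and> f ` domain B \<subseteq> elts \<kappa>)" for B :: 'a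
  have f: "inj_on (f B) (domain B) \<and> f B ` domain B \<subseteq> elts \<kappa>" if "B \<in> C'" for B
  proof -
    have "\<exists>h. inj_on h (domain B) \<and> h ` domain B \<subseteq> elts \<kappa>"
      using that by (simp add: C'_def lepoll_def)
    from someI_ex[OF this] show ?thesis
      unfolding f_def .
  qed
  define code where "code B = theory_code L B (f B)" for B
  define T where "T = Pow ({\<phi>. wf_fm L \<phi>} \<times> {v :: nat \<Rightarrow> 'a. range v \<subseteq> elts \<kappa>})"
  have "code ` C' \<subseteq> T"
    using f unfolding code_def T_def theory_code_def by fastforce
  moreover have "T \<prec> elts \<delta>"
  proof -
    have fms: "{\<phi>. wf_fm L \<phi>} \<prec> elts \<delta>"
      using countable_wf_fm[OF L] nat_lesspoll[OF \<delta>] lesspoll_trans1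
      by (metis countable_def lepoll_def subset_UNIV)
    \<comment> \<open>An assignment is determined by its graph.\<close>
    have "{v :: nat \<Rightarrow> 'a. range v \<subseteq> elts \<kappa>} \<lesssim> Pow ((UNIV :: nat set) \<times> elts \<kappa>)"
      unfolding lepoll_def
    proof (intro exI conjI)
      show "inj_on (\<lambda>v. range (\<lambda>n. (n, v n))) {v :: nat \<Rightarrow> 'a. range v \<subseteq> elts \<kappa>}"
      proof (rule inj_onI, rule ext)
        fix v w :: "nat \<Rightarrow> 'a" and n
        assume "range (\<lambda>n. (n, v n)) = range (\<lambda>n. (n, w n))"
        then have "(n, v n) \<in> range (\<lambda>n. (n, w n))"
          by blast
        then show "v n = w n"
          by blast
      qed
    qed auto
    moreover have "Pow ((UNIV :: nat set) \<times> elts \<kappa>) \<prec> elts \<delta>"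
      using \<delta> \<kappa> by (intro Pow_lesspoll Times_lesspoll nat_lesspoll) (auto intro: lepoll_elem_lesspoll)
    ultimately have "{v :: nat \<Rightarrow> 'a. range v \<subseteq> elts \<kappa>} \<prec> elts \<delta>"
      by (rule lesspoll_trans1)
    then show ?thesis
      unfolding T_def using Pow_lesspoll[OF \<delta>] Times_lesspoll[OF \<delta> fms] by blast
  qed
  ultimately have "code ` C' \<prec> elts \<delta>"
    by (rule lesspoll_trans1[OF subset_imp_lepoll])
  define rep where "rep = inv_into C' code"
  define K where "K = rep ` code ` C'"
  have "K \<prec> elts \<delta>"
    unfolding K_def using \<open>code ` C' \<prec> elts \<delta>\<close> image_lepoll lesspoll_trans1 by blast
  have K_sub: "K \<subseteq> C'"
    unfolding K_def rep_def by (auto simp: inv_into_into)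
  then have "K \<subseteq> Vset \<delta>"
    using C by (auto simp: C'_def)
  then obtain \<alpha> where \<alpha>: "\<alpha> \<in> elts \<delta>" "K \<subseteq> Vset \<alpha>"
    using lesspoll_subset_Vset[OF \<delta> \<open>K \<prec> elts \<delta>\<close>] by blast
  show thesis
  proof
    show "\<alpha> \<in> elts \<delta>"
      by fact
    fix B assume "B \<in> C" "domain B \<lesssim> elts \<kappa>"
    then have B: "B \<in> C'"
      by (simp add: C'_def)
    define A where "A = rep (code B)"
    have "A \<in> K"
      using B by (auto simp: A_def K_def)
    moreover have "code A = code B"
      unfolding A_def rep_def using B by (simp add: f_inv_into_f)
    then have "\<exists>j. elementary_embedding L j A B"
      using theory_code_embedding f B \<open>A \<in> K\<close> K_sub unfolding code_def by blast
    ultimately show "\<exists>A\<in>C \<inter> Vset \<alpha>. \<exists>j. elementary_embedding L j A B"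
      using \<alpha>(2) K_sub by (auto simp: C'_def)
  qed
qed

section \<open>The equivalences\<close>

text \<open>A small structure embedding into \<open>B\<close> is itself the target of an embedding
  from a representative in a fixed level; the two embeddings compose.\<close>

lemma SR_imp_VSR:
  assumes \<delta>: "inaccessible \<delta>" and C: "structures_of_type L (elts C)" "elts C \<subseteq> Vset \<delta>"
    and \<kappa>: "\<kappa> \<in> elts \<delta>" "SR L (elts C) \<kappa>"
  shows "\<exists>\<mu>\<in>elts \<delta>. infinite_cardinal \<mu> \<and> VSR L (elts C) \<mu>"
proof -
  obtain \<alpha> where \<alpha>: "\<alpha> \<in> elts \<delta>" "\<And>B. B \<in> elts C \<Longrightarrow> domain B \<lesssim> elts \<kappa> \<Longrightarrow>
      \<exists>A\<in>elts C \<inter> Vset \<alpha>. \<exists>j. elementary_embedding L j A B"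
    using Vset_representatives[OF \<delta> _ C(2) \<kappa>(1)] C(1) unfolding structures_of_type_def by blast
  obtain \<mu> where \<mu>: "\<mu> \<in> elts \<delta>" "infinite_cardinal \<mu>" "elts \<alpha> \<prec> elts \<mu>"
    using inaccessible_cardinal_above[OF \<delta>] lepoll_elem_lesspoll[OF \<delta> \<alpha>(1)] by blast
  have "elts \<alpha> \<subseteq> elts \<mu>"
  proof -
    have "ordinal \<alpha>" "ordinal \<mu>"
      using \<alpha>(1) \<mu>(1) inaccessible_ordinal[OF \<delta>] ordinal_elem by blast+
    moreover have "\<mu> \<notin> elts \<alpha>"
      using \<mu>(3) \<open>ordinal \<alpha>\<close> not_lesspoll_iff ordinal_trans subset_imp_lepoll subsetI by metis
    ultimately show ?thesis
      using ordinal_not_mem_iff by blast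
  qed
  then have "Vset \<alpha> \<subseteq> Vset \<mu>"
    by (rule Vset_mono)
  have "VSR L (elts C) \<mu>"
    unfolding VSR_def
  proof
    fix B assume "B \<in> elts C"
    then obtain A j where A: "A \<in> elts C" "domain A \<prec> elts \<kappa>" "elementary_embedding L j A B"
      using \<kappa>(2) unfolding SR_def by blast
    then obtain A' i where "A' \<in> elts C \<inter> Vset \<alpha>" "elementary_embedding L i A' A"
      using \<alpha>(2) lesspoll_imp_lepoll by blast
    then show "\<exists>A\<in>elts C \<inter> Vset \<mu>. \<exists>j. elementary_embedding L j A B"
      using A(3) elementary_embedding_trans \<open>Vset \<alpha> \<subseteq> Vset \<mu>\<close> by blast
  qed
  then show ?thesis
    using \<mu> by blast
qed

text \<open>Each member of the transitive set \<open>Vset \<kappa>\<close> has its transitive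
  closure inside it, so any \<mu> larger than the cardinality of \<open>Vset \<kappa>\<close>
  works.\<close>

lemma VSR_imp_HSR:
  assumes \<delta>: "inaccessible \<delta>" and \<kappa>: "\<kappa> \<in> elts \<delta>" "VSR L C \<kappa>"
  shows "\<exists>\<mu>\<in>elts \<delta>. infinite_cardinal \<mu> \<and> HSR L C \<mu>"
proof -
  obtain \<mu> where \<mu>: "\<mu> \<in> elts \<delta>" "infinite_cardinal \<mu>" "Vset \<kappa> \<prec> elts \<mu>"
    using inaccessible_cardinal_above[OF \<delta> Vset_lesspoll[OF \<delta> \<kappa>(1)]] .
  have "Vset \<kappa> \<subseteq> Hset \<mu>"
  proof
    fix x assume "x \<in> Vset \<kappa>"
    then have "trcl x \<subseteq> Vset \<kappa>"
      using trcl_subset_Vset ordinal_elem inaccessible_ordinal[OF \<delta>] \<kappa>(1) by blast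
    then show "x \<in> Hset \<mu>"
      using \<mu>(3) lesspoll_trans1 subset_imp_lepoll unfolding Hset_def by blast
  qed
  then show ?thesis
    using \<mu> \<kappa>(2) unfolding VSR_def HSR_def by blast
qed

lemma HSR_imp_VSR: "cardinal \<kappa> \<Longrightarrow> HSR L C \<kappa> \<Longrightarrow> VSR L C \<kappa>"
  using Hset_subset_Vset unfolding HSR_def VSR_def by blast

text \<open>Among the structures of \<open>C\<close> into which no smaller member of \<open>C\<close> embeds, keep one for each
  cardinality. Embeddings do not decrease the cardinality, so there is none between two different
  ones of these.\<close>

lemma vopenka_imp_SR:
  fixes \<delta> :: "'a::zfc_universe"
  assumes \<delta>: "vopenka_cardinal \<delta>"
    and C: "structures_of_type L (elts C)" "elts C \<subseteq> Vset \<delta>"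
  shows "\<exists>\<kappa>\<in>elts \<delta>. infinite_cardinal \<kappa> \<and> SR L (elts C) \<kappa>"
proof (rule ccontr)
  assume no_SR: "\<not> ?thesis"
  have inacc: "inaccessible \<delta>"
    using \<delta> by (simp add: vopenka_cardinal_def)
  note ord = inaccessible_ordinal[OF inacc]
  define M where "M = {B \<in> elts C. \<forall>A\<in>elts C. \<forall>j. elementary_embedding L j A B \<longrightarrow> \<not> domain A \<prec> domain B}"
  define rep where "rep B = (SOME A. A \<in> M \<and> domain A \<approx> domain B)" for B :: 'a
  have rep: "rep B \<in> M \<and> domain (rep B) \<approx> domain B" if "B \<in> M" for B
    unfolding rep_def by (rule someI[of _ B]) (use that in auto)
  \<comment> \<open>The choice depends only on the cardinality of the domain, because equipollent
    domains give the same predicate to choose from.\<close>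
  have rep_eq: "rep A = rep B" if "domain A \<approx> domain B" for A B
  proof -
    have "D \<approx> domain A \<longleftrightarrow> D \<approx> domain B" for D :: "'a set"
      using that eqpoll_sym eqpoll_trans by blast
    then show ?thesis
      by (simp add: rep_def)
  qed
  define C' where "C' = mkset (rep ` M)"
  have "small M"
    by (rule small_subset[of "elts C"]) (auto simp: M_def)
  then have elts_C': "elts C' = rep ` M"
    by (simp add: C'_def small_image)
  have "elts C' \<subseteq> elts C"
    using rep by (auto simp: elts_C' M_def)
  \<comment> \<open>If \<open>C'\<close> were inside \<open>Vset \<beta>\<close>, all domains in it
    would be smaller than \<kappa>. Failure of SR at \<kappa> gives \<open>B\<close>, and a smallest
    structure embedding into \<open>B\<close> lies in \<open>M\<close> and has a representative in
    \<open>C'\<close>, so it is too small.\<close>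
  have "\<not> elts C' \<subseteq> Vset \<beta>" if \<beta>: "\<beta> \<in> elts \<delta>" for \<beta>
  proof
    assume sub: "elts C' \<subseteq> Vset \<beta>"
    obtain \<kappa> where \<kappa>: "\<kappa> \<in> elts \<delta>" "infinite_cardinal \<kappa>" "Vset \<beta> \<prec> elts \<kappa>"
      using inaccessible_cardinal_above[OF inacc Vset_lesspoll[OF inacc \<beta>]] .
    then obtain B where B: "B \<in> elts C"
      "\<And>A j. A \<in> elts C \<Longrightarrow> elementary_embedding L j A B \<Longrightarrow> \<not> domain A \<prec> elts \<kappa>"
      using no_SR unfolding SR_def by blast
    have dom_bound: "\<exists>\<gamma>\<in>elts \<delta>. domain A \<lesssim> elts \<gamma>" if A: "A \<in> elts C" for A
    proof -
      obtain \<eta> where \<eta>: "\<eta> \<in> elts \<delta>" "elts A \<subseteq> Vset \<eta>"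
        using A C(2) mem_Vset_iff by blast
      have "trcl A \<subseteq> Vset \<eta>"
        using \<eta> trcl_subset_Vset[of \<eta>] Vset_trans[of \<eta>] ordinal_elem[OF ord] by (subst trcl_eq) blast
      then have "domain A \<prec> elts \<delta>"
        using Vset_lesspoll[OF inacc \<eta>(1)] domain_subset_trcl[of L A] A C(1)
          lesspoll_trans1 subset_imp_lepoll unfolding structures_of_type_def by (meson subset_trans)
      then show ?thesis
        using lesspoll_cardinal_bound[OF inaccessible_cardinal[OF inacc]] by blast
    qed
    \<comment> \<open>Sizes are measured by ordinals, so that Foundation yields a smallest
      one.\<close>
    define G where "G = {\<gamma> :: 'a. ordinal \<gamma> \<and>
      (\<exists>A\<in>elts C. (\<exists>j. elementary_embedding L j A B) \<and> domain A \<lesssim> elts \<gamma>)}"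
    obtain \<gamma>\<^sub>0 where "\<gamma>\<^sub>0 \<in> elts \<delta>" "domain B \<lesssim> elts \<gamma>\<^sub>0"
      using dom_bound[OF B(1)] by blast
    then have "\<gamma>\<^sub>0 \<in> G"
      using B(1) elementary_embedding_refl ordinal_elem[OF ord] unfolding G_def by blast
    then obtain \<gamma> where \<gamma>: "\<gamma> \<in> G" "\<And>\<eta>. \<eta> \<in> elts \<gamma> \<Longrightarrow> \<eta> \<notin> G"
      by (rule mem_minimal) blast
    then obtain A j where A: "A \<in> elts C" "elementary_embedding L j A B" "domain A \<lesssim> elts \<gamma>"
      unfolding G_def by blast
    have not_below: "\<not> domain A' \<lesssim> elts \<eta>"
      if "A' \<in> elts C" "elementary_embedding L i A' A" "\<eta> \<in> elts \<gamma>" for A' i \<eta>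
      using that \<gamma> A(2) elementary_embedding_trans ordinal_elem unfolding G_def by blast
    \<comment> \<open>Minimality makes \<gamma> a cardinal, so a domain smaller than \<gamma>
      injects into some \<eta> < \<gamma>.\<close>
    have "\<not> elts \<eta> \<approx> elts \<gamma>" if "\<eta> \<in> elts \<gamma>" for \<eta>
      using not_below[OF A(1) elementary_embedding_refl that] A(3) eqpoll_sym lepoll_trans2 by blast
    then have "cardinal \<gamma>"
      using \<gamma>(1) by (auto simp: cardinal_def G_def)
    have "A \<in> M"
    proof -
      have "\<not> domain A' \<prec> domain A" if A': "A' \<in> elts C" "elementary_embedding L i A' A" for A' i
      proof
        assume "domain A' \<prec> domain A"
        then have "domain A' \<prec> elts \<gamma>"
          using A(3) lesspoll_trans2 by blast
        then show False
          using lesspoll_cardinal_bound[OF \<open>cardinal \<gamma>\<close>] not_below[OF A'] by blast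
      qed
      then show ?thesis
        using A(1) by (auto simp: M_def)
    qed
    then have A': "rep A \<in> elts C'" "domain (rep A) \<approx> domain A"
      using rep by (auto simp: elts_C')
    moreover obtain D Q where "rep A = pair D Q"
      using C(1) A'(1) \<open>elts C' \<subseteq> elts C\<close> unfolding structures_of_type_def is_structure_def by blast
    ultimately have "domain (rep A) \<subseteq> Vset \<beta>"
      using domain_subset_Vset[OF ordinal_elem[OF ord \<beta>]] sub by auto
    then have "domain (rep A) \<prec> elts \<kappa>"
      using \<kappa>(3) lesspoll_trans1 subset_imp_lepoll by blast
    then have "domain A \<prec> elts \<kappa>"
      using A'(2) eq_lesspoll_trans eqpoll_sym by blast
    then show False
      using B(2) A by blast
  qed
  then have "C' \<in> Vset (succ \<delta>) - Vset \<delta>"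
    using C(2) \<open>elts C' \<subseteq> elts C\<close> mem_Vset_succ_iff[OF ord] mem_Vset_iff[of C'] by blast
  moreover have "structures_of_type L (elts C')"
    using C(1) \<open>elts C' \<subseteq> elts C\<close> by (auto simp: structures_of_type_def)
  ultimately obtain A B j where "A \<in> elts C'" "B \<in> elts C'" "A \<noteq> B" and j: "elementary_embedding L j A B"
    using \<delta> unfolding vopenka_cardinal_def by blast
  then obtain A\<^sub>0 B\<^sub>0 where AB: "A\<^sub>0 \<in> M" "B\<^sub>0 \<in> M" "A = rep A\<^sub>0" "B = rep B\<^sub>0" "A \<noteq> B"
    by (auto simp: elts_C')
  then have "A \<in> elts C" "\<not> domain A \<prec> domain B"
    using rep[of A\<^sub>0] rep[of B\<^sub>0] j by (auto simp: M_def)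
  then have "domain A \<approx> domain B"
    using elementary_embedding_lepoll[OF j] lesspoll_def by blast
  then have "domain A\<^sub>0 \<approx> domain B\<^sub>0"
    using rep[OF AB(1)] rep[OF AB(2)] unfolding AB(3,4) by (meson eqpoll_sym eqpoll_trans)
  then show False
    using rep_eq AB(3-5) by blast
qed

text \<open>As \<open>C\<close> is not in \<open>Vset \<delta>\<close>, some \<open>B\<close> in it
  lies outside \<open>Vset \<kappa>\<close>, whereas the structure reflecting \<open>B\<close> lies
  inside; hence they differ.\<close>

lemma VSR_imp_embedding:
  assumes "C \<notin> Vset \<delta>" "\<kappa> \<in> elts \<delta>" "VSR L (elts C) \<kappa>"
  shows "\<exists>A\<in>elts C. \<exists>B\<in>elts C. A \<noteq> B \<and> (\<exists>j. elementary_embedding L j A B)"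
proof -
  obtain B where "B \<in> elts C" "B \<notin> Vset \<kappa>"
    using assms(1,2) mem_Vset_iff by blast
  moreover from this obtain A j where "A \<in> elts C" "A \<in> Vset \<kappa>" "elementary_embedding L j A B"
    using assms(3) unfolding VSR_def by blast
  ultimately show ?thesis
    by metis
qed

theorem theorem1p7:
  fixes \<delta> :: "'a::zfc_universe"
  assumes "uncountable_cardinal \<delta>"
  shows "(vopenka_cardinal \<delta> \<longleftrightarrow>
           (\<forall>L C. structures_of_type L (elts C) \<and> C \<in> Vset (succ \<delta>) - Vset \<delta> \<longrightarrow>
              (\<exists>\<kappa>\<in>elts \<delta>. infinite_cardinal \<kappa> \<and> SR L (elts C) \<kappa>))) \<and>
         (vopenka_cardinal \<delta> \<longleftrightarrow>
           (\<forall>L C. structures_of_type L (elts C) \<and> C \<in> Vset (succ \<delta>) - Vset \<delta> \<longrightarrow>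
              (\<exists>\<kappa>\<in>elts \<delta>. infinite_cardinal \<kappa> \<and> HSR L (elts C) \<kappa>))) \<and>
         (vopenka_cardinal \<delta> \<longleftrightarrow>
           (\<forall>L C. structures_of_type L (elts C) \<and> C \<in> Vset (succ \<delta>) - Vset \<delta> \<longrightarrow>
              (\<exists>\<kappa>\<in>elts \<delta>. infinite_cardinal \<kappa> \<and> VSR L (elts C) \<kappa>)))"
    (is "(_ \<longleftrightarrow> ?SR) \<and> (_ \<longleftrightarrow> ?HSR) \<and> (_ \<longleftrightarrow> ?VSR)")
proof -
  have ord: "ordinal \<delta>"
    using assms by (simp add: uncountable_cardinal_def cardinal_def)
  have sub: "elts C \<subseteq> Vset \<delta>" if "C \<in> Vset (succ \<delta>) - Vset \<delta>" for C
    using that mem_Vset_succ_iff[OF ord] by blast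
  have inacc: "inaccessible \<delta>" if "?SR \<or> ?VSR"
    using reflection_imp_inaccessible[OF assms] that by blast
  \<comment> \<open>The Vopenka property, \<open>?SR\<close> and \<open>?VSR\<close> form a cycle of
    implications, and \<open>?HSR\<close> is equivalent to \<open>?VSR\<close>. Inaccessibility
    comes from \<open>?SR\<close> or \<open>?VSR\<close>.\<close>
  have "vopenka_cardinal \<delta> \<Longrightarrow> ?SR"
    using vopenka_imp_SR sub by blast
  moreover have "?SR \<Longrightarrow> ?VSR"
    using SR_imp_VSR inacc sub by meson
  moreover have "?VSR \<Longrightarrow> ?HSR"
    using VSR_imp_HSR inacc by meson
  moreover have "?HSR \<Longrightarrow> ?VSR"
    using HSR_imp_VSR unfolding infinite_cardinal_def by meson
  moreover have "?VSR \<Longrightarrow> vopenka_cardinal \<delta>"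
    unfolding vopenka_cardinal_def using inacc VSR_imp_embedding by (meson DiffD2)
  ultimately show ?thesis
    by argo
qed

end
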